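(* Let $A(B)^C$ be a $C$-Galois extension over a field $k$, let $(A,C)_\psi$ be the canonical entwining structure associated to it, and let $M$ be an $A$-bimodule. Then: (1) There is a $k$-linear isomorphism $H^0_\psi(A,M)\cong M^B:=\{m\in M\mid b\cdot m=m\cdot b \text{ for all } b\in B\}$. (2) If $A$ is a $C$-Galois object, i.e. $B=k$ (meaning $B=k1_A$), then $H^n_\psi(A,M)=0$ for all $n>0$.
   Context: $k$ is a field, $\otimes=\otimes_k$; algebras are associative and unital, coalgebras are coassociative and counital; $\mathrm{Hom}$ means $k$-linear maps; $V^n=V^{\otimes n}$ (with $V^0=k$). $C$-Galois extension $A(B)^C$: $C$ is a coalgebra, $A$ is an algebra and a right $C$-comodule with coaction $\rho^A:A\to A\otimes C$; $B:=\{b\in A\mid \rho^A(ba)=b\rho^A(a)\ \text{for all } a\in A\}$ (a subalgebra of $A$); and the canonical left $A$-module, right $C$-comodule map $\mathrm{can}:A\otimes_BA\to A\otimes C$, $a\otimes a'\mapsto a\rho^A(a')$, is bijective. The canonical entwining structure associated to $A(B)^C$ is given by $\psi:C\otimes A\to A\otimes C$, $\psi(c\otimes a)=\mathrm{can}(\mathrm{can}^{-1}(1\otimes c)a)$. It is known that $(A,C)_\psi$ is an entwining structure, i.e., writing $\psi(c\otimes a)=a_\alpha\otimes c^\alpha$ (summation understood) and $\Delta(c)=c_{(1)}\otimes c_{(2)}$, for all $a,a'\in A$, $c\in C$: $(aa')_\alpha\otimes c^\alpha=a_\alpha a'_\beta\otimes c^{\alpha\beta}$; $1_\alpha\otimes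 c^\alpha=1\otimes c$; $a_\alpha\otimes (c^\alpha)_{(1)}\otimes (c^\alpha)_{(2)}=a_{\beta\alpha}\otimes c_{(1)}{}^\alpha\otimes c_{(2)}{}^\beta$; $a_\alpha\epsilon(c^\alpha)=a\epsilon(c)$. For an $A$-bimodule $M$, $C_\psi(A,M)$ is the cochain complex with $C^n_\psi(A,M)=\mathrm{Hom}(C\otimes A^n,M)$, $n\ge 0$, and $$d^nf(c,a^1,\ldots,a^{n+1})=a^1_\alpha\cdot f(c^\alpha,a^2,\ldots,a^{n+1})+\sum_{i=1}^n(-1)^if(c,a^1,\ldots,a^ia^{i+1},\ldots,a^{n+1})+(-1)^{n+1}f(c,a^1,\ldots,a^n)\cdot a^{n+1}.$$ Its cohomology is denoted $H^\bullet_\psi(A,M)$. *)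

theory Defs
  imports
    Complex_Main
    "HOL-Library.Poly_Mapping"
    "HOL-Library.Set_Algebras"
    "HOL-Library.Function_Algebras"
begin

text \<open>
  The algebra, the coalgebra and the bimodule live on whole types and use the library locale
  \<^locale>\<open>vector_space\<close>.  Tensor products, cochain spaces and cohomology are vector spaces on a
  carrier set; their addition is that of the type class \<^class>\<open>plus\<close> (for cosets, the elementwise
  addition of sets from \<^theory>\<open>HOL-Library.Set_Algebras\<close>; for functions, the pointwise one from
  \<^theory>\<open>HOL-Library.Function_Algebras\<close>).
\<close>

record ('k, 'v) kspace =
  carr :: "'v set"
  scal :: "'k \<Rightarrow> 'v \<Rightarrow> 'v"

definition vs :: "('k \<Rightarrow> 'v \<Rightarrow> 'v) \<Rightarrow> ('k, 'v) kspace" where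
  "vs s = \<lparr>carr = UNIV, scal = s\<rparr>"

text \<open>Linear maps are normalised to be \<open>0\<close> outside the source, so that equality of maps is
  equality of functions.\<close>

definition Hom :: "('k, 'v::plus) kspace \<Rightarrow> ('k, 'w::{plus,zero}) kspace \<Rightarrow> ('v \<Rightarrow> 'w) set" where
  "Hom V W = {f. (\<forall>x\<in>carr V. f x \<in> carr W) \<and> (\<forall>x. x \<notin> carr V \<longrightarrow> f x = 0) \<and>
     (\<forall>x\<in>carr V. \<forall>y\<in>carr V. f (x + y) = f x + f y) \<and>
     (\<forall>r. \<forall>x\<in>carr V. f (scal V r x) = scal W r (f x))}"

definition kspace_iso :: "('k, 'v::plus) kspace \<Rightarrow> ('k, 'w::{plus,zero}) kspace \<Rightarrow> bool" where
  "kspace_iso V W \<longleftrightarrow> (\<exists>f\<in>Hom V W. bij_betw f (carr V) (carr W))"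

text \<open>The linear map with prescribed values \<open>g x\<close> at the elements \<open>p x\<close>, \<open>x \<in> G\<close>, of a
  generating family of \<open>V\<close>.\<close>

definition linear_ext ::
  "('k, 'v::plus) kspace \<Rightarrow> ('k, 'w::{plus,zero}) kspace \<Rightarrow> 'x set \<Rightarrow> ('x \<Rightarrow> 'v) \<Rightarrow> ('x \<Rightarrow> 'w) \<Rightarrow> 'v \<Rightarrow> 'w"
  where
  "linear_ext V W G p g = (THE f. f \<in> Hom V W \<and> (\<forall>x\<in>G. f (p x) = g x))"

text \<open>The elements of the quotient are the cosets \<open>x + N\<close>.  Adding \<open>N\<close> in the scalar
  multiplication matters only for the scalar \<open>0\<close>.\<close>

definition quotient_space ::
  "('k, 'v::ab_group_add) kspace \<Rightarrow> 'v set \<Rightarrow> ('k, 'v set) kspace" where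
  "quotient_space V N = \<lparr>carr = (\<lambda>x. x +o N) ` carr V, scal = (\<lambda>r X. scal V r ` X + N)\<rparr>"

definition free_scale :: "'k::field \<Rightarrow> ('x \<Rightarrow>\<^sub>0 'k) \<Rightarrow> ('x \<Rightarrow>\<^sub>0 'k)" where
  "free_scale r x = Poly_Mapping.map ((*) r) x"

definition gen :: "'x \<Rightarrow> ('x \<Rightarrow>\<^sub>0 'k::field)" where
  "gen p = Poly_Mapping.single p 1"

definition free_space :: "'x set \<Rightarrow> ('k::field, 'x \<Rightarrow>\<^sub>0 'k) kspace" where
  "free_space G = \<lparr>carr = {x. Poly_Mapping.keys x \<subseteq> G}, scal = free_scale\<rparr>"

definition free_span :: "('x \<Rightarrow>\<^sub>0 'k::field) set \<Rightarrow> ('x \<Rightarrow>\<^sub>0 'k) set" where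
  "free_span R = module.span free_scale R"

text \<open>Relations making the generator \<open>g v\<close> depend linearly on \<open>v\<close>.\<close>

definition linear_rels ::
  "('k::field, 'v::plus) kspace \<Rightarrow> ('v \<Rightarrow> 'x) \<Rightarrow> ('x \<Rightarrow>\<^sub>0 'k) set" where
  "linear_rels V g =
     {gen (g (u + v)) - gen (g u) - gen (g v) | u v. u \<in> carr V \<and> v \<in> carr V} \<union>
     {gen (g (scal V r v)) - free_scale r (gen (g v)) | r v. v \<in> carr V}"

definition bilinear_rels ::
  "('k::field, 'v::plus) kspace \<Rightarrow> ('k, 'w::plus) kspace \<Rightarrow> ('v \<times> 'w \<Rightarrow>\<^sub>0 'k) set" where
  "bilinear_rels V W =
     (\<Union>w\<in>carr W. linear_rels V (\<lambda>v. (v, w))) \<union> (\<Union>v\<in>carr V. linear_rels W (\<lambda>w. (v, w)))"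

definition tensor ::
  "('k::field, 'v::plus) kspace \<Rightarrow> ('k, 'w::plus) kspace \<Rightarrow> ('k, ('v \<times> 'w \<Rightarrow>\<^sub>0 'k) set) kspace"
  (infixr \<open>\<otimes>\<close> 75) where
  "V \<otimes> W = quotient_space (free_space (carr V \<times> carr W)) (free_span (bilinear_rels V W))"

definition pure_tensor ::
  "('k::field, 'v::plus) kspace \<Rightarrow> ('k, 'w::plus) kspace \<Rightarrow> 'v \<Rightarrow> 'w \<Rightarrow> ('v \<times> 'w \<Rightarrow>\<^sub>0 'k) set" where
  "pure_tensor V W v w = gen (v, w) +o free_span (bilinear_rels V W)"

text \<open>The linear map \<open>V \<otimes> W \<rightarrow> U\<close> with \<open>v \<otimes> w \<mapsto> \<beta> v w\<close>, for bilinear \<open>\<beta>\<close>.  In Sweedler-type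
  notation, its value at \<open>t = \<Sum> v\<^sub>i \<otimes> w\<^sub>i\<close> is \<open>\<Sum> \<beta> v\<^sub>i w\<^sub>i\<close>.\<close>

definition tensor_lift ::
  "('k::field, 'v::plus) kspace \<Rightarrow> ('k, 'w::plus) kspace \<Rightarrow> ('k, 'u::{plus,zero}) kspace \<Rightarrow>
   ('v \<Rightarrow> 'w \<Rightarrow> 'u) \<Rightarrow> ('v \<times> 'w \<Rightarrow>\<^sub>0 'k) set \<Rightarrow> 'u" where
  "tensor_lift V W U \<beta> =
     linear_ext (V \<otimes> W) U (carr V \<times> carr W) (\<lambda>(v, w). pure_tensor V W v w) (\<lambda>(v, w). \<beta> v w)"

definition words :: "'v set \<Rightarrow> nat \<Rightarrow> 'v list set" where
  "words S n = {xs. set xs \<subseteq> S \<and> length xs = n}"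

definition multilinear_rels ::
  "('k::field, 'v::plus) kspace \<Rightarrow> nat \<Rightarrow> ('v list \<Rightarrow>\<^sub>0 'k) set" where
  "multilinear_rels V n =
     (\<Union>(xs, ys) \<in> {(xs, ys). xs @ ys \<in> words (carr V) (n - 1) \<and> n > 0}.
        linear_rels V (\<lambda>v. xs @ v # ys))"

text \<open>The tensor power \<open>V\<^sup>n\<close>; for \<open>n = 0\<close> it is the free space on the empty word, i.e. \<open>k\<close>.\<close>

definition tensor_power ::
  "('k::field, 'v::plus) kspace \<Rightarrow> nat \<Rightarrow> ('k, ('v list \<Rightarrow>\<^sub>0 'k) set) kspace" where
  "tensor_power V n = quotient_space (free_space (words (carr V) n)) (free_span (multilinear_rels V n))"

definition pure_power ::
  "('k::field, 'v::plus) kspace \<Rightarrow> nat \<Rightarrow> 'v list \<Rightarrow> ('v list \<Rightarrow>\<^sub>0 'k) set" where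
  "pure_power V n xs = gen xs +o free_span (multilinear_rels V n)"

text \<open>The sort of \<open>'a\<close> is that of unital rings without the library's requirement \<open>0 \<noteq> 1\<close>.\<close>

locale k_algebra = A: vector_space scale
  for scale :: "'k::field \<Rightarrow> 'a::{ring,monoid_mult} \<Rightarrow> 'a" +
  assumes scale_mult_left: "scale r a * b = scale r (a * b)"
    and scale_mult_right: "a * scale r b = scale r (a * b)"

locale k_coalgebra = C: vector_space sC
  for sC :: "'k::field \<Rightarrow> 'c::ab_group_add \<Rightarrow> 'c" +
  fixes \<Delta> :: "'c \<Rightarrow> ('c \<times> 'c \<Rightarrow>\<^sub>0 'k) set"
    and \<epsilon> :: "'c \<Rightarrow> 'k"
  assumes comult_hom: "\<Delta> \<in> Hom (vs sC) (vs sC \<otimes> vs sC)"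
    and counit_hom: "\<epsilon> \<in> Hom (vs sC) (vs (*))"
    and coassoc:
      "tensor_lift (vs sC) (vs sC) (vs sC \<otimes> vs sC \<otimes> vs sC)
         (\<lambda>x y. tensor_lift (vs sC) (vs sC) (vs sC \<otimes> vs sC \<otimes> vs sC)
            (\<lambda>x1 x2. pure_tensor (vs sC) (vs sC \<otimes> vs sC) x1 (pure_tensor (vs sC) (vs sC) x2 y)) (\<Delta> x))
         (\<Delta> c) =
       tensor_lift (vs sC) (vs sC) (vs sC \<otimes> vs sC \<otimes> vs sC)
         (\<lambda>x y. pure_tensor (vs sC) (vs sC \<otimes> vs sC) x (\<Delta> y)) (\<Delta> c)"
    and counit_left: "tensor_lift (vs sC) (vs sC) (vs sC) (\<lambda>x y. sC (\<epsilon> x) y) (\<Delta> c) = c"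
    and counit_right: "tensor_lift (vs sC) (vs sC) (vs sC) (\<lambda>x y. sC (\<epsilon> y) x) (\<Delta> c) = c"

locale right_comodule = k_coalgebra sC \<Delta> \<epsilon> + V: vector_space sV
  for sC :: "'k::field \<Rightarrow> 'c::ab_group_add \<Rightarrow> 'c"
    and \<Delta> :: "'c \<Rightarrow> ('c \<times> 'c \<Rightarrow>\<^sub>0 'k) set"
    and \<epsilon> :: "'c \<Rightarrow> 'k"
    and sV :: "'k \<Rightarrow> 'v::ab_group_add \<Rightarrow> 'v" +
  fixes \<rho> :: "'v \<Rightarrow> ('v \<times> 'c \<Rightarrow>\<^sub>0 'k) set"
  assumes coact_hom: "\<rho> \<in> Hom (vs sV) (vs sV \<otimes> vs sC)"
    and coact_coassoc:
      "tensor_lift (vs sV) (vs sC) (vs sV \<otimes> vs sC \<otimes> vs sC)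
         (\<lambda>v c. tensor_lift (vs sV) (vs sC) (vs sV \<otimes> vs sC \<otimes> vs sC)
            (\<lambda>v' c'. pure_tensor (vs sV) (vs sC \<otimes> vs sC) v' (pure_tensor (vs sC) (vs sC) c' c)) (\<rho> v))
         (\<rho> x) =
       tensor_lift (vs sV) (vs sC) (vs sV \<otimes> vs sC \<otimes> vs sC)
         (\<lambda>v c. pure_tensor (vs sV) (vs sC \<otimes> vs sC) v (\<Delta> c)) (\<rho> x)"
    and coact_counit: "tensor_lift (vs sV) (vs sC) (vs sV) (\<lambda>v c. sV (\<epsilon> c) v) (\<rho> x) = x"

locale bimodule = k_algebra sA + M: vector_space sM
  for sA :: "'k::field \<Rightarrow> 'a::{ring,monoid_mult} \<Rightarrow> 'a"
    and sM :: "'k \<Rightarrow> 'm::ab_group_add \<Rightarrow> 'm" +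
  fixes lact :: "'a \<Rightarrow> 'm \<Rightarrow> 'm"
    and ract :: "'m \<Rightarrow> 'a \<Rightarrow> 'm"
  assumes lact_add_left: "lact (a + b) m = lact a m + lact b m"
    and lact_add_right: "lact a (m + m') = lact a m + lact a m'"
    and lact_scale_left: "lact (sA r a) m = sM r (lact a m)"
    and lact_scale_right: "lact a (sM r m) = sM r (lact a m)"
    and lact_mult: "lact (a * b) m = lact a (lact b m)"
    and lact_one: "lact 1 m = m"
    and ract_add_left: "ract (m + m') a = ract m a + ract m' a"
    and ract_add_right: "ract m (a + b) = ract m a + ract m b"
    and ract_scale_left: "ract (sM r m) a = sM r (ract m a)"
    and ract_scale_right: "ract m (sA r a) = sM r (ract m a)"
    and ract_mult: "ract m (a * b) = ract (ract m a) b"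
    and ract_one: "ract m 1 = m"
    and lact_ract: "ract (lact a m) b = lact a (ract m b)"

definition balanced_rels ::
  "('k::field \<Rightarrow> 'a::{ring,monoid_mult} \<Rightarrow> 'a) \<Rightarrow> 'a set \<Rightarrow> ('a \<times> 'a \<Rightarrow>\<^sub>0 'k) set" where
  "balanced_rels sA B =
     bilinear_rels (vs sA) (vs sA) \<union> {gen (a * b, a') - gen (a, b * a') | a b a'. b \<in> B}"

definition tensor_over ::
  "('k::field \<Rightarrow> 'a::{ring,monoid_mult} \<Rightarrow> 'a) \<Rightarrow> 'a set \<Rightarrow> ('k, ('a \<times> 'a \<Rightarrow>\<^sub>0 'k) set) kspace" where
  "tensor_over sA B = quotient_space (free_space UNIV) (free_span (balanced_rels sA B))"

definition pure_over ::
  "('k::field \<Rightarrow> 'a::{ring,monoid_mult} \<Rightarrow> 'a) \<Rightarrow> 'a set \<Rightarrow> 'a \<Rightarrow> 'a \<Rightarrow> ('a \<times> 'a \<Rightarrow>\<^sub>0 'k) set" where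
  "pure_over sA B a a' = gen (a, a') +o free_span (balanced_rels sA B)"

text \<open>The right \<open>A\<close>-action \<open>(a' \<otimes> a'') \<cdot> a = a' \<otimes> a'' a\<close> on \<open>A \<otimes>\<^sub>B A\<close> and the left \<open>A\<close>-action
  \<open>a \<cdot> (a' \<otimes> c) = a a' \<otimes> c\<close> on \<open>A \<otimes> C\<close>.\<close>

definition right_mult ::
  "('k::field \<Rightarrow> 'a::{ring,monoid_mult} \<Rightarrow> 'a) \<Rightarrow> 'a set \<Rightarrow>
   ('a \<times> 'a \<Rightarrow>\<^sub>0 'k) set \<Rightarrow> 'a \<Rightarrow> ('a \<times> 'a \<Rightarrow>\<^sub>0 'k) set" where
  "right_mult sA B t a =
     linear_ext (tensor_over sA B) (tensor_over sA B) UNIV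
       (\<lambda>(a', a''). pure_over sA B a' a'') (\<lambda>(a', a''). pure_over sA B a' (a'' * a)) t"

definition left_mult ::
  "('k::field \<Rightarrow> 'a::{ring,monoid_mult} \<Rightarrow> 'a) \<Rightarrow> ('k \<Rightarrow> 'c::ab_group_add \<Rightarrow> 'c) \<Rightarrow>
   'a \<Rightarrow> ('a \<times> 'c \<Rightarrow>\<^sub>0 'k) set \<Rightarrow> ('a \<times> 'c \<Rightarrow>\<^sub>0 'k) set" where
  "left_mult sA sC a t =
     tensor_lift (vs sA) (vs sC) (vs sA \<otimes> vs sC) (\<lambda>a' c. pure_tensor (vs sA) (vs sC) (a * a') c) t"

definition coinvariants ::
  "('k::field \<Rightarrow> 'a::{ring,monoid_mult} \<Rightarrow> 'a) \<Rightarrow> ('k \<Rightarrow> 'c::ab_group_add \<Rightarrow> 'c) \<Rightarrow>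
   ('a \<Rightarrow> ('a \<times> 'c \<Rightarrow>\<^sub>0 'k) set) \<Rightarrow> 'a set" where
  "coinvariants sA sC \<rho> = {b. \<forall>a. \<rho> (b * a) = left_mult sA sC b (\<rho> a)}"

definition can ::
  "('k::field \<Rightarrow> 'a::{ring,monoid_mult} \<Rightarrow> 'a) \<Rightarrow> ('k \<Rightarrow> 'c::ab_group_add \<Rightarrow> 'c) \<Rightarrow>
   ('a \<Rightarrow> ('a \<times> 'c \<Rightarrow>\<^sub>0 'k) set) \<Rightarrow> ('a \<times> 'a \<Rightarrow>\<^sub>0 'k) set \<Rightarrow> ('a \<times> 'c \<Rightarrow>\<^sub>0 'k) set" where
  "can sA sC \<rho> =
     linear_ext (tensor_over sA (coinvariants sA sC \<rho>)) (vs sA \<otimes> vs sC) UNIV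
       (\<lambda>(a, a'). pure_over sA (coinvariants sA sC \<rho>) a a') (\<lambda>(a, a'). left_mult sA sC a (\<rho> a'))"

locale galois_extension = k_algebra sA + right_comodule sC \<Delta> \<epsilon> sA \<rho>
  for sA :: "'k::field \<Rightarrow> 'a::{ring,monoid_mult} \<Rightarrow> 'a"
    and sC :: "'k \<Rightarrow> 'c::ab_group_add \<Rightarrow> 'c"
    and \<Delta> :: "'c \<Rightarrow> ('c \<times> 'c \<Rightarrow>\<^sub>0 'k) set"
    and \<epsilon> :: "'c \<Rightarrow> 'k"
    and \<rho> :: "'a \<Rightarrow> ('a \<times> 'c \<Rightarrow>\<^sub>0 'k) set" +
  assumes can_bij:
    "bij_betw (can sA sC \<rho>) (carr (tensor_over sA (coinvariants sA sC \<rho>))) (carr (vs sA \<otimes> vs sC))"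

definition canonical_entwining ::
  "('k::field \<Rightarrow> 'a::{ring,monoid_mult} \<Rightarrow> 'a) \<Rightarrow> ('k \<Rightarrow> 'c::ab_group_add \<Rightarrow> 'c) \<Rightarrow>
   ('a \<Rightarrow> ('a \<times> 'c \<Rightarrow>\<^sub>0 'k) set) \<Rightarrow> ('c \<times> 'a \<Rightarrow>\<^sub>0 'k) set \<Rightarrow> ('a \<times> 'c \<Rightarrow>\<^sub>0 'k) set" where
  "canonical_entwining sA sC \<rho> =
     (let B = coinvariants sA sC \<rho>;
          can_inv = inv_into (carr (tensor_over sA B)) (can sA sC \<rho>)
      in tensor_lift (vs sC) (vs sA) (vs sA \<otimes> vs sC)
           (\<lambda>c a. can sA sC \<rho> (right_mult sA B (can_inv (pure_tensor (vs sA) (vs sC) 1 c)) a)))"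

definition cochains ::
  "('k::field \<Rightarrow> 'a::{ring,monoid_mult} \<Rightarrow> 'a) \<Rightarrow> ('k \<Rightarrow> 'c::ab_group_add \<Rightarrow> 'c) \<Rightarrow>
   ('k \<Rightarrow> 'm::ab_group_add \<Rightarrow> 'm) \<Rightarrow> nat \<Rightarrow>
   ('k, ('c \<times> ('a list \<Rightarrow>\<^sub>0 'k) set \<Rightarrow>\<^sub>0 'k) set \<Rightarrow> 'm) kspace" where
  "cochains sA sC sM n =
     \<lparr>carr = Hom (vs sC \<otimes> tensor_power (vs sA) n) (vs sM), scal = (\<lambda>r f t. sM r (f t))\<rparr>"

text \<open>The element \<open>c \<otimes> a\<^sup>1 \<otimes> \<dots> \<otimes> a\<^sup>n\<close> of \<open>C \<otimes> A\<^sup>n\<close>, where \<open>as\<close> is the list of the \<open>a\<^sup>i\<close>.\<close>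

definition chain_elem ::
  "('k::field \<Rightarrow> 'a::{ring,monoid_mult} \<Rightarrow> 'a) \<Rightarrow> ('k \<Rightarrow> 'c::ab_group_add \<Rightarrow> 'c) \<Rightarrow>
   'c \<Rightarrow> 'a list \<Rightarrow> ('c \<times> ('a list \<Rightarrow>\<^sub>0 'k) set \<Rightarrow>\<^sub>0 'k) set" where
  "chain_elem sA sC c as =
     pure_tensor (vs sC) (tensor_power (vs sA) (length as)) c (pure_power (vs sA) (length as) as)"

text \<open>\<open>a\<^sup>1, \<dots>, a\<^sup>i a\<^sup>i\<^sup>+\<^sup>1, \<dots>\<close>: superscripts count from 1, list positions from 0.\<close>

definition contract :: "nat \<Rightarrow> 'a::times list \<Rightarrow> 'a list" where
  "contract i as = take (i - 1) as @ (as ! (i - 1) * as ! i) # drop (i + 1) as"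

definition coboundary ::
  "('k::field \<Rightarrow> 'a::{ring,monoid_mult} \<Rightarrow> 'a) \<Rightarrow> ('k \<Rightarrow> 'c::ab_group_add \<Rightarrow> 'c) \<Rightarrow>
   (('c \<times> 'a \<Rightarrow>\<^sub>0 'k) set \<Rightarrow> ('a \<times> 'c \<Rightarrow>\<^sub>0 'k) set) \<Rightarrow>
   ('k \<Rightarrow> 'm::ab_group_add \<Rightarrow> 'm) \<Rightarrow> ('a \<Rightarrow> 'm \<Rightarrow> 'm) \<Rightarrow> ('m \<Rightarrow> 'a \<Rightarrow> 'm) \<Rightarrow> nat \<Rightarrow>
   (('c \<times> ('a list \<Rightarrow>\<^sub>0 'k) set \<Rightarrow>\<^sub>0 'k) set \<Rightarrow> 'm) \<Rightarrow>
   ('c \<times> ('a list \<Rightarrow>\<^sub>0 'k) set \<Rightarrow>\<^sub>0 'k) set \<Rightarrow> 'm" where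
  "coboundary sA sC \<psi> sM lact ract n f =
     linear_ext (vs sC \<otimes> tensor_power (vs sA) (n + 1)) (vs sM) (UNIV \<times> words UNIV (n + 1))
       (\<lambda>(c, as). chain_elem sA sC c as)
       (\<lambda>(c, as).
          tensor_lift (vs sA) (vs sC) (vs sM)
            (\<lambda>a c'. lact a (f (chain_elem sA sC c' (tl as))))
            (\<psi> (pure_tensor (vs sC) (vs sA) c (hd as)))
          + (\<Sum>i = 1..n. sM ((-1) ^ i) (f (chain_elem sA sC c (contract i as))))
          + sM ((-1) ^ (n + 1)) (ract (f (chain_elem sA sC c (butlast as))) (last as)))"

definition cocycles where
  "cocycles sA sC \<psi> sM lact ract n =
     {f \<in> carr (cochains sA sC sM n). coboundary sA sC \<psi> sM lact ract n f = 0}"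

definition coboundaries where
  "coboundaries sA sC \<psi> sM lact ract n =
     (case n of 0 \<Rightarrow> {0}
      | Suc j \<Rightarrow> coboundary sA sC \<psi> sM lact ract j ` carr (cochains sA sC sM j))"

definition cohomology where
  "cohomology sA sC \<psi> sM lact ract n =
     quotient_space
       \<lparr>carr = cocycles sA sC \<psi> sM lact ract n, scal = scal (cochains sA sC sM n)\<rparr>
       (coboundaries sA sC \<psi> sM lact ract n)"

end

theory Submission
  imports Defs
begin

text \<open>
  Bijectivity of the canonical map identifies a linear map \<open>\<phi> : C \<rightarrow> M\<close> with the left \<open>B\<close>-linear
  map \<open>G : A \<rightarrow> M\<close>, \<open>G y = y\<^sub>(\<^sub>0\<^sub>) \<cdot> \<phi>(y\<^sub>(\<^sub>1\<^sub>))\<close>; the inverse is \<open>\<phi> c = \<Sum> x\<^sub>i \<cdot> G y\<^sub>i\<close>, where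
  \<open>\<Sum> x\<^sub>i \<otimes>\<^sub>B y\<^sub>i = can\<^sup>-\<^sup>1(1 \<otimes> c)\<close>.  Under this identification the entwined term
  \<open>a\<^sub>\<alpha> \<cdot> \<phi>(c\<^sup>\<alpha>)\<close> of the coboundary becomes \<open>G(y a)\<close>, so the complex turns into the complex of left
  \<open>B\<close>-linear maps \<open>A \<otimes> A\<^sup>n \<rightarrow> M\<close> with a Hochschild-type differential.  A cocycle of degree \<open>0\<close> is then
  \<open>y \<mapsto> m y\<close> with \<open>m = G 1 \<in> M\<^sup>B\<close>.  If \<open>B = k\<close>, inserting \<open>1\<close> in the first argument is a contracting
  homotopy in positive degrees.
\<close>

text \<open>The origin of the correspondence: A \<otimes> C is the free left A-module on C, so left
  A-linear maps A \<otimes> C \<rightarrow> M amount to linear maps C \<rightarrow> M, while left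
  A-linear maps A \<otimes>_B A \<rightarrow> M amount to left B-linear maps A \<rightarrow> M. As
  \<open>can\<close> is a left A-linear bijection between the two modules, composition with it
  matches the two kinds of maps. The correspondence acts on the variable c alone; the remaining
  arguments form a list that is only a parameter.

  Much of the text serves the encoding. Tensor products are sets of cosets inside a larger type, and
  maps out of them are definite descriptions, so no value can be computed before existence (the
  relations are respected) and uniqueness (agreement on generators) are known. For C \<otimes> A^n,
  a quotient built over a quotient, both arguments have two layers.\<close>

section \<open>Free vector spaces and normalised linear maps\<close>

lemma lookup_free_scale [simp]:
  "Poly_Mapping.lookup (free_scale r x) p = r * Poly_Mapping.lookup x p"
  by (simp add: free_scale_def Poly_Mapping.map.rep_eq when_def)

interpretation free: vector_space "free_scale :: 'k::field \<Rightarrow> ('x \<Rightarrow>\<^sub>0 'k) \<Rightarrow> _"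
  by unfold_locales (auto intro!: poly_mapping_eqI simp: lookup_add algebra_simps)

lemma keys_free_scale: "Poly_Mapping.keys (free_scale r x) \<subseteq> Poly_Mapping.keys x"
  by (auto simp: in_keys_iff)

lemma subspace_free_span: "free.subspace (free_span R)"
  by (simp add: free_span_def)

lemma carr_vs [simp]: "carr (vs s) = UNIV" and scal_vs [simp]: "scal (vs s) = s"
  by (simp_all add: vs_def)

lemma HomI:
  assumes "\<And>x. x \<in> carr V \<Longrightarrow> f x \<in> carr W" "\<And>x. x \<notin> carr V \<Longrightarrow> f x = 0"
    "\<And>x y. x \<in> carr V \<Longrightarrow> y \<in> carr V \<Longrightarrow> f (x + y) = f x + f y"
    "\<And>r x. x \<in> carr V \<Longrightarrow> f (scal V r x) = scal W r (f x)"
  shows "f \<in> Hom V W"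
  using assms by (auto simp: Hom_def)

lemma Hom_add: "f \<in> Hom V W \<Longrightarrow> x \<in> carr V \<Longrightarrow> y \<in> carr V \<Longrightarrow> f (x + y) = f x + f y"
  and Hom_scal: "f \<in> Hom V W \<Longrightarrow> x \<in> carr V \<Longrightarrow> f (scal V r x) = scal W r (f x)"
  and Hom_carr: "f \<in> Hom V W \<Longrightarrow> x \<in> carr V \<Longrightarrow> f x \<in> carr W"
  and Hom_outside: "f \<in> Hom V W \<Longrightarrow> x \<notin> carr V \<Longrightarrow> f x = 0"
  by (auto simp: Hom_def)

lemma Hom_vs_iff:
  "f \<in> Hom (vs s) W \<longleftrightarrow> (\<forall>x. f x \<in> carr W) \<and> (\<forall>x y. f (x + y) = f x + f y) \<and> (\<forall>r x. f (s r x) = scal W r (f x))"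
  by (auto simp: Hom_def)

section \<open>Quotients of free spaces\<close>

abbreviation quot :: "'x set \<Rightarrow> ('x \<Rightarrow>\<^sub>0 'k::field) set \<Rightarrow> ('k, ('x \<Rightarrow>\<^sub>0 'k) set) kspace" where
  "quot G R \<equiv> quotient_space (free_space G) (free_span R)"

lemma coset_eq_iff:
  "x +o free_span R = y +o free_span R \<longleftrightarrow> x - y \<in> free_span R"
proof
  assume "x +o free_span R = y +o free_span R"
  moreover have "x \<in> x +o free_span R"
    using free.subspace_0[OF subspace_free_span] by (force simp: elt_set_plus_def)
  ultimately show "x - y \<in> free_span R" by (auto simp: elt_set_plus_def)
next
  assume d: "x - y \<in> free_span R"
  have "z \<in> x +o free_span R \<longleftrightarrow> z \<in> y +o free_span R" for z
  proof -
    have "z - x \<in> free_span R \<longleftrightarrow> z - y \<in> free_span R"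
      using free.subspace_add[OF subspace_free_span _ d, of "z - x"]
        free.subspace_diff[OF subspace_free_span _ d, of "z - y"] by auto
    moreover have "z \<in> w +o free_span R \<longleftrightarrow> z - w \<in> free_span R" for w
      by (auto simp: elt_set_plus_def) (metis add.commute diff_add_cancel)
    ultimately show ?thesis by simp
  qed
  then show "x +o free_span R = y +o free_span R" by blast
qed

lemma coset_add: "(x +o free_span R) + (y +o free_span R) = (x + y) +o free_span R"
proof -
  have "free_span R + free_span R = free_span R"
  proof
    show "free_span R + free_span R \<subseteq> free_span R"
      by (auto simp: set_plus_def intro: free.subspace_add[OF subspace_free_span])
    show "free_span R \<subseteq> free_span R + free_span R"
      using free.subspace_0[OF subspace_free_span] by (force simp: set_plus_def)
  qed
  then show ?thesis by (simp add: set_plus_rearrange)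
qed

lemma coset_scal: "scal (quot G R) r (x +o free_span R) = free_scale r x +o free_span R"
proof -
  have "free_scale r ` (x +o free_span R) + free_span R = free_scale r x +o free_span R" (is "?l = ?r")
  proof
    show "?l \<subseteq> ?r"
    proof
      fix z assume "z \<in> ?l"
      then obtain n m where "n \<in> free_span R" "m \<in> free_span R" "z = free_scale r (x + n) + m"
        by (auto simp: set_plus_def elt_set_plus_def)
      then have "z = free_scale r x + (free_scale r n + m)" "free_scale r n + m \<in> free_span R"
        using subspace_free_span
        by (auto simp: free.scale_right_distrib add.assoc intro: free.subspace_add free.subspace_scale)
      then show "z \<in> ?r" by (auto simp: elt_set_plus_def)
    qed
    show "?r \<subseteq> ?l"
    proof
      fix z assume "z \<in> ?r"
      \<comment> \<open>The representative \<open>x + 0\<close> stays fixed and \<open>n\<close> is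
        taken from the added copy of the subspace. No division by \<open>r\<close> occurs, so
        \<open>r = 0\<close> is covered.\<close>
      then obtain n where "n \<in> free_span R" "z = free_scale r (x + 0) + n"
        by (auto simp: elt_set_plus_def)
      then show "z \<in> ?l"
        using free.subspace_0[OF subspace_free_span, of R] unfolding set_plus_def elt_set_plus_def
        by blast
    qed
  qed
  then show ?thesis by (simp add: quotient_space_def free_space_def)
qed

lemma carr_quot: "carr (quot G R) = (\<lambda>x. x +o free_span R) ` {x. Poly_Mapping.keys x \<subseteq> G}"
  by (simp add: quotient_space_def free_space_def)

lemma coset_in_quot: "Poly_Mapping.keys x \<subseteq> G \<Longrightarrow> x +o free_span R \<in> carr (quot G R)"
  by (auto simp: carr_quot)

lemma keys_gen [simp]: "Poly_Mapping.keys (gen p :: 'x \<Rightarrow>\<^sub>0 'k::field) = {p}"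
  by (simp add: gen_def)

lemma gen_in_quot: "p \<in> G \<Longrightarrow> gen p +o free_span R \<in> carr (quot G R)"
  by (rule coset_in_quot) simp

lemma quot_add_closed:
  assumes "X \<in> carr (quot G R)" "Y \<in> carr (quot G R)"
  shows "X + Y \<in> carr (quot G R)"
proof -
  obtain x y where "X = x +o free_span R" "Poly_Mapping.keys x \<subseteq> G"
    "Y = y +o free_span R" "Poly_Mapping.keys y \<subseteq> G"
    using assms by (auto simp: carr_quot)
  then show ?thesis
    using Poly_Mapping.keys_add[of x y] by (auto simp: coset_add intro!: coset_in_quot)
qed

lemma quot_scal_closed:
  assumes "X \<in> carr (quot G R)"
  shows "scal (quot G R) r X \<in> carr (quot G R)"
proof -
  obtain x where "X = x +o free_span R" "Poly_Mapping.keys x \<subseteq> G"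
    using assms by (auto simp: carr_quot)
  then show ?thesis
    using keys_free_scale[of r x] by (auto simp: coset_scal intro!: coset_in_quot)
qed

text \<open>There is no separate case for the zero coset: it arises as 0 times a generator, which is
  why \<open>G\<close> must be nonempty.\<close>

lemma quot_induct [consumes 2, case_names gen add scal]:
  assumes "X \<in> carr (quot G R)" "G \<noteq> {}"
    and gen: "\<And>p. p \<in> G \<Longrightarrow> P (gen p +o free_span R)"
    and add: "\<And>X Y. \<lbrakk>X \<in> carr (quot G R); Y \<in> carr (quot G R); P X; P Y\<rbrakk> \<Longrightarrow> P (X + Y)"
    and scal: "\<And>r X. \<lbrakk>X \<in> carr (quot G R); P X\<rbrakk> \<Longrightarrow> P (scal (quot G R) r X)"
  shows "P X"
proof -
  have main: "P (x +o free_span R)" if "Poly_Mapping.keys x \<subseteq> G" for x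
    using that
  proof (induction "card (Poly_Mapping.keys x)" arbitrary: x)
    case 0
    obtain p where p: "p \<in> G" using assms(2) by blast
    have "x = 0" using 0 by simp
    then have "x +o free_span R = scal (quot G R) 0 (gen p +o free_span R)"
      by (simp add: coset_scal)
    then show ?case using scal[OF gen_in_quot[OF p] gen[OF p], of 0] by simp
  next
    case (Suc n)
    then obtain p where p: "p \<in> Poly_Mapping.keys x" by (metis card.empty ex_in_conv nat.distinct(1))
    \<comment> \<open>Subtracting the \<open>p\<close>-component removes exactly the key
      \<open>p\<close>, so the number of keys drops by one.\<close>
    define y where "y = x - free_scale (Poly_Mapping.lookup x p) (gen p)"
    have ky: "Poly_Mapping.keys y = Poly_Mapping.keys x - {p}"
      by (auto simp: y_def in_keys_iff lookup_minus gen_def lookup_single when_def split: if_splits)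
    then have "card (Poly_Mapping.keys y) = n" using Suc(2) p by simp
    moreover have yG: "Poly_Mapping.keys y \<subseteq> G" using ky Suc.prems by blast
    ultimately have "P (y +o free_span R)" using Suc.hyps(1) by blast
    moreover have "P (scal (quot G R) (Poly_Mapping.lookup x p) (gen p +o free_span R))"
      using p Suc.prems by (intro scal gen gen_in_quot) auto
    ultimately have "P ((y +o free_span R) + scal (quot G R) (Poly_Mapping.lookup x p) (gen p +o free_span R))"
      using p Suc.prems
      by (intro add coset_in_quot quot_scal_closed gen_in_quot yG) auto
    then show ?case by (simp add: coset_scal coset_add y_def)
  qed
  then show ?thesis using assms(1) by (auto simp: carr_quot)
qed

text \<open>The uniqueness half of the universal property. It yields equality of functions because
  members of \<open>Hom\<close> vanish off the carrier.\<close>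

lemma Hom_quot_eqI:
  assumes "f \<in> Hom (quot G R) W" "f' \<in> Hom (quot G R) W" "G \<noteq> {}"
    "\<And>p. p \<in> G \<Longrightarrow> f (gen p +o free_span R) = f' (gen p +o free_span R)"
  shows "f = f'"
proof
  fix X show "f X = f' X"
  proof (cases "X \<in> carr (quot G R)")
    case True
    then show ?thesis using assms(3)
      by (induction rule: quot_induct)
        (simp_all add: assms(4) Hom_add[OF assms(1)] Hom_add[OF assms(2)]
          Hom_scal[OF assms(1)] Hom_scal[OF assms(2)])
  next
    case False
    then show ?thesis using assms(1,2) by (simp add: Hom_outside)
  qed
qed

text \<open>\<open>linear_rels\<close> describes a single slot. Allowing any larger \<open>R\<close>
  lets the same computation serve tensor products, tensor powers and the tensor product over
  \<open>B\<close>.\<close>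

lemma linear_rels_coset:
  assumes "linear_rels V g \<subseteq> R" "u \<in> carr V"
  shows "v \<in> carr V \<Longrightarrow> gen (g (u + v)) +o free_span R = (gen (g u) +o free_span R) + (gen (g v) +o free_span R)"
    and "gen (g (scal V r u)) +o free_span R = scal (quot G R) r (gen (g u) +o free_span R)"
proof -
  have sub: "R \<subseteq> free_span R" by (simp add: free_span_def free.span_superset)
  show "gen (g (u + v)) +o free_span R = (gen (g u) +o free_span R) + (gen (g v) +o free_span R)" if "v \<in> carr V"
  proof -
    have "gen (g (u + v)) - gen (g u) - gen (g v) \<in> linear_rels V g"
      using that assms(2) unfolding linear_rels_def by blast
    then show ?thesis using assms(1) sub by (auto simp: coset_add coset_eq_iff diff_diff_eq)
  qed
  have "gen (g (scal V r u)) - free_scale r (gen (g u)) \<in> linear_rels V g"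
    using assms(2) unfolding linear_rels_def by blast
  then show "gen (g (scal V r u)) +o free_span R = scal (quot G R) r (gen (g u) +o free_span R)"
    using assms(1) sub by (auto simp: coset_scal coset_eq_iff)
qed

section \<open>Linear extension\<close>

definition free_ext :: "('k::field \<Rightarrow> 'u::ab_group_add \<Rightarrow> 'u) \<Rightarrow> ('x \<Rightarrow> 'u) \<Rightarrow> ('x \<Rightarrow>\<^sub>0 'k) \<Rightarrow> 'u" where
  "free_ext s h x = (\<Sum>p\<in>Poly_Mapping.keys x. s (Poly_Mapping.lookup x p) (h p))"

context vector_space
begin

text \<open>Keys may cancel in a sum or disappear under scaling by 0, so sums over different key
  sets are compared over a common finite index set.\<close>

lemma free_ext_superset:
  assumes "finite S" "Poly_Mapping.keys x \<subseteq> S"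
  shows "free_ext scale h x = (\<Sum>p\<in>S. scale (Poly_Mapping.lookup x p) (h p))"
  unfolding free_ext_def
  by (rule sum.mono_neutral_left) (use assms in \<open>auto simp: in_keys_iff\<close>)

lemma free_ext_add: "free_ext scale h (x + y) = free_ext scale h x + free_ext scale h y"
proof -
  let ?S = "Poly_Mapping.keys x \<union> Poly_Mapping.keys y"
  show ?thesis
    using Poly_Mapping.keys_add[of x y]
    by (simp add: free_ext_superset[of ?S] lookup_add scale_left_distrib sum.distrib)
qed

lemma free_ext_scale: "free_ext scale h (free_scale r x) = scale r (free_ext scale h x)"
  by (simp add: free_ext_superset[of "Poly_Mapping.keys x"] keys_free_scale scale_sum_right)

lemma free_ext_diff: "free_ext scale h (x - y) = free_ext scale h x - free_ext scale h y"
  using free_ext_add[of h "x - y" y] by (simp add: algebra_simps)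

lemma free_ext_gen: "free_ext scale h (gen p) = h p"
  by (simp add: free_ext_def) (simp add: gen_def)

end

text \<open>The tensor products are not types, so they are not instances of \<^locale>\<open>vector_space\<close>; what
  linear extension needs of its target is that it is a linear image of a vector space.\<close>

locale linear_image = vector_space s
  for s :: "'k::field \<Rightarrow> 'u::ab_group_add \<Rightarrow> 'u" +
  fixes W :: "('k, 'w::{plus,zero}) kspace" and \<pi> :: "'u \<Rightarrow> 'w"
  assumes image_add: "\<pi> (x + y) = \<pi> x + \<pi> y"
    and image_scale: "\<pi> (s r x) = scal W r (\<pi> x)"
    and range_image: "range \<pi> = carr W"
begin

text \<open>The \<open>0\<close> of the type of \<open>W\<close> need not be the zero vector of
  \<open>W\<close>: for cosets it is \<open>{0}\<close>, whereas \<open>\<pi> 0\<close> is the whole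
  subspace. Kernels are therefore expressed by the value \<open>\<pi> 0\<close>.\<close>

lemma image_diff_eq: "\<pi> (x - y) = \<pi> 0 \<longleftrightarrow> \<pi> x = \<pi> y"
  by (metis (no_types) add.group_left_neutral diff_add_cancel image_add right_minus_eq uminus_add_conv_diff)

end

text \<open>Expresses that \<open>g\<close> respects the relation \<open>r\<close>. Since
  \<open>W\<close> has no subtraction, the three shapes of relations are listed separately:
  additivity, homogeneity, and balancing over \<open>B\<close>.\<close>

definition compatible ::
  "('k::field, 'w::plus) kspace \<Rightarrow> 'x set \<Rightarrow> ('x \<Rightarrow> 'w) \<Rightarrow> ('x \<Rightarrow>\<^sub>0 'k) \<Rightarrow> bool" where
  "compatible W G g r \<longleftrightarrow>
     (\<exists>a\<in>G. \<exists>b\<in>G. \<exists>c\<in>G. r = gen a - gen b - gen c \<and> g a = g b + g c) \<or>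
     (\<exists>a\<in>G. \<exists>b\<in>G. \<exists>q. r = gen a - free_scale q (gen b) \<and> g a = scal W q (g b)) \<or>
     (\<exists>a\<in>G. \<exists>b\<in>G. r = gen a - gen b \<and> g a = g b)"

text \<open>The existence half of the universal property. \<open>g\<close> is lifted along
  \<open>\<pi>\<close> to a map \<open>h\<close> into an honest vector space, where finite sums are
  available. The linear extension of \<open>h\<close> need not kill \<open>R\<close>, but its
  composite with \<open>\<pi>\<close> sends \<open>R\<close> to the zero of \<open>W\<close> and so
  factors through the cosets.\<close>

lemma (in linear_image) linear_ext_quot:
  assumes "G \<noteq> {}" and g: "\<And>p. p \<in> G \<Longrightarrow> g p \<in> carr W"
    and R: "\<And>r. r \<in> R \<Longrightarrow> compatible W G g r"
    and p: "\<And>x. x \<in> G \<Longrightarrow> p x = gen x +o free_span R"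
  shows "linear_ext (quot G R) W G p g \<in> Hom (quot G R) W" (is ?A)
    and "\<And>x. x \<in> G \<Longrightarrow> linear_ext (quot G R) W G p g (p x) = g x"
proof -
  define h where "h x = (SOME u. \<pi> u = g x)" for x
  have h: "\<pi> (h x) = g x" if "x \<in> G" for x
    unfolding h_def by (rule someI_ex) (metis g[OF that] range_image imageE)
  define \<Phi> where "\<Phi> = free_ext s h"
  have \<Phi>: "\<Phi> (x + y) = \<Phi> x + \<Phi> y" "\<Phi> (x - y) = \<Phi> x - \<Phi> y" "\<Phi> (free_scale q x) = s q (\<Phi> x)" "\<Phi> (gen z) = h z"
    for x y q z by (simp_all add: \<Phi>_def free_ext_add free_ext_diff free_ext_scale free_ext_gen)
  have R0: "\<pi> (\<Phi> r) = \<pi> 0" if "r \<in> R" for r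
    using R[OF that] unfolding compatible_def
    by (auto simp: \<Phi> image_diff_eq h diff_diff_eq image_add image_scale)
  have sub: "free.subspace {x. \<pi> (\<Phi> x) = \<pi> 0}"
  proof (rule free.subspaceI)
    have "\<Phi> 0 = 0" using \<Phi>(2)[of 0 0] by simp
    then show "0 \<in> {x. \<pi> (\<Phi> x) = \<pi> 0}" by simp
    show "x + y \<in> {x. \<pi> (\<Phi> x) = \<pi> 0}" if "x \<in> {x. \<pi> (\<Phi> x) = \<pi> 0}" "y \<in> {x. \<pi> (\<Phi> x) = \<pi> 0}" for x y
      using that by (simp add: \<Phi> image_add) (metis image_add add_0)
    show "free_scale c x \<in> {x. \<pi> (\<Phi> x) = \<pi> 0}" if "x \<in> {x. \<pi> (\<Phi> x) = \<pi> 0}" for c x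
      using that by (simp add: \<Phi> image_scale) (metis image_scale scale_zero_right)
  qed
  have N: "\<pi> (\<Phi> x) = \<pi> 0" if "x \<in> free_span R" for x
    using that free.span_minimal[OF _ sub, of R] R0 unfolding free_span_def by blast
  have wd: "\<pi> (\<Phi> x) = \<pi> (\<Phi> y)" if "x +o free_span R = y +o free_span R" for x y
    using N[of "x - y"] that by (simp add: coset_eq_iff \<Phi> image_diff_eq)
  \<comment> \<open>The chosen representative may have keys outside \<open>G\<close>. This is
    harmless, as \<open>wd\<close> speaks about all representatives.\<close>
  define f where "f X = (if X \<in> carr (quot G R) then \<pi> (\<Phi> (SOME x. X = x +o free_span R)) else 0)" for X
  have f: "f (x +o free_span R) = \<pi> (\<Phi> x)" if "Poly_Mapping.keys x \<subseteq> G" for x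
  proof -
    have "x +o free_span R = (SOME y. x +o free_span R = y +o free_span R) +o free_span R"
      by (rule someI_ex) blast
    then show ?thesis using coset_in_quot[OF that, of R] wd by (metis f_def)
  qed
  have fH: "f \<in> Hom (quot G R) W"
  proof (rule HomI)
    fix X assume "X \<in> carr (quot G R)"
    then obtain x where x: "X = x +o free_span R" "Poly_Mapping.keys x \<subseteq> G" by (auto simp: carr_quot)
    show "f X \<in> carr W" using x f range_image by auto
    show "f (scal (quot G R) r X) = scal W r (f X)" for r
      using f[OF x(2)] f[OF order_trans[OF keys_free_scale x(2)]] by (simp add: x(1) coset_scal \<Phi> image_scale)
    fix Y assume "Y \<in> carr (quot G R)"
    then obtain y where y: "Y = y +o free_span R" "Poly_Mapping.keys y \<subseteq> G" by (auto simp: carr_quot)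
    have "Poly_Mapping.keys (x + y) \<subseteq> G" using x(2) y(2) Poly_Mapping.keys_add[of x y] by blast
    then show "f (X + Y) = f X + f Y"
      by (simp add: x y coset_add f \<Phi> image_add)
  qed (simp add: f_def)
  have fg: "f (p x) = g x" if "x \<in> G" for x
    using that by (simp add: p f \<Phi> h)
  have "linear_ext (quot G R) W G p g = f"
    unfolding linear_ext_def
    by (rule the_equality) (use fH fg p in \<open>auto intro!: Hom_quot_eqI[OF _ fH \<open>G \<noteq> {}\<close>]\<close>)
  then show ?A "\<And>x. x \<in> G \<Longrightarrow> linear_ext (quot G R) W G p g (p x) = g x"
    using fH fg by simp_all
qed

lemma linear_image_vs: "vector_space s \<Longrightarrow> linear_image s (vs s) id"
  by (simp add: linear_image_def linear_image_axioms_def)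

text \<open>Restricted to \<open>UNIV\<close> because \<open>range\<close> runs over the entire free
  space. That covers the targets A \<otimes> C and A \<otimes>_B A; C \<otimes> A^n occurs only as a
  source.\<close>

lemma linear_image_quot: "linear_image free_scale (quot UNIV R) (\<lambda>x. x +o free_span R)"
  by unfold_locales (simp_all add: coset_add coset_scal carr_quot)

section \<open>Tensor products\<close>

text \<open>What a factor of a tensor product has to provide: sums and multiples of its elements
  must again index generators.\<close>

definition closed_space :: "('k, 'v::plus) kspace \<Rightarrow> bool" where
  "closed_space V \<longleftrightarrow> carr V \<noteq> {} \<and> (\<forall>x\<in>carr V. \<forall>y\<in>carr V. x + y \<in> carr V) \<and>
     (\<forall>r. \<forall>x\<in>carr V. scal V r x \<in> carr V)"

lemma closed_space_vs [simp]: "closed_space (vs s)"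
  by (simp add: closed_space_def)

lemma closed_space_quot: "G \<noteq> {} \<Longrightarrow> closed_space (quot G R)"
  using gen_in_quot by (fastforce simp: closed_space_def intro: quot_add_closed quot_scal_closed)

text \<open>Works slot by slot: \<open>e\<close> inserts a vector into one slot, and the relations
  of that slot ask only for linearity of \<open>g\<close> in it.\<close>

lemma compatible_linear_rels:
  assumes "closed_space V" "(\<lambda>v. g (e v)) \<in> Hom V W" "\<And>v. v \<in> carr V \<Longrightarrow> e v \<in> G" "r \<in> linear_rels V e"
  shows "compatible W G g r"
proof -
  consider u v where "u \<in> carr V" "v \<in> carr V" "r = gen (e (u + v)) - gen (e u) - gen (e v)"
    | q u where "u \<in> carr V" "r = gen (e (scal V q u)) - free_scale q (gen (e u))"
    using assms(4) unfolding linear_rels_def by blast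
  then show ?thesis
  proof cases
    case (1 u v)
    then have "e u \<in> G" "e v \<in> G" "e (u + v) \<in> G" "g (e (u + v)) = g (e u) + g (e v)"
      using assms(1,3) Hom_add[OF assms(2)] by (auto simp: closed_space_def)
    then show ?thesis unfolding compatible_def 1(3) by blast
  next
    case (2 q u)
    then have "e u \<in> G" "e (scal V q u) \<in> G" "g (e (scal V q u)) = scal W q (g (e u))"
      using assms(1,3) Hom_scal[OF assms(2)] by (auto simp: closed_space_def)
    then show ?thesis unfolding compatible_def 2(2) by blast
  qed
qed

lemma tensor_eq_quot: "V \<otimes> W = quot (carr V \<times> carr W) (bilinear_rels V W)"
  by (simp add: tensor_def)

lemma pure_tensor_carr: "v \<in> carr V \<Longrightarrow> w \<in> carr W \<Longrightarrow> pure_tensor V W v w \<in> carr (V \<otimes> W)"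
  unfolding pure_tensor_def tensor_eq_quot by (rule gen_in_quot) simp

lemma closed_space_tensor:
  "closed_space V \<Longrightarrow> closed_space W \<Longrightarrow> closed_space (V \<otimes> W)"
  unfolding tensor_eq_quot by (rule closed_space_quot) (auto simp: closed_space_def)

lemma pure_tensor_left:
  assumes "w \<in> carr W" "u \<in> carr V"
  shows "v \<in> carr V \<Longrightarrow> pure_tensor V W (u + v) w = pure_tensor V W u w + pure_tensor V W v w"
    and "pure_tensor V W (scal V r u) w = scal (V \<otimes> W) r (pure_tensor V W u w)"
proof -
  have "linear_rels V (\<lambda>v. (v, w)) \<subseteq> bilinear_rels V W"
    using assms(1) by (auto simp: bilinear_rels_def)
  from linear_rels_coset[OF this assms(2)]
  show "v \<in> carr V \<Longrightarrow> pure_tensor V W (u + v) w = pure_tensor V W u w + pure_tensor V W v w"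
    "pure_tensor V W (scal V r u) w = scal (V \<otimes> W) r (pure_tensor V W u w)"
    unfolding pure_tensor_def tensor_eq_quot by auto
qed

lemma pure_tensor_right:
  assumes "v \<in> carr V" "u \<in> carr W"
  shows "w \<in> carr W \<Longrightarrow> pure_tensor V W v (u + w) = pure_tensor V W v u + pure_tensor V W v w"
    and "pure_tensor V W v (scal W r u) = scal (V \<otimes> W) r (pure_tensor V W v u)"
proof -
  have "linear_rels W (\<lambda>w. (v, w)) \<subseteq> bilinear_rels V W"
    using assms(1) by (auto simp: bilinear_rels_def)
  from linear_rels_coset[OF this assms(2)]
  show "w \<in> carr W \<Longrightarrow> pure_tensor V W v (u + w) = pure_tensor V W v u + pure_tensor V W v w"
    "pure_tensor V W v (scal W r u) = scal (V \<otimes> W) r (pure_tensor V W v u)"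
    unfolding pure_tensor_def tensor_eq_quot by auto
qed

lemma (in linear_image) tensor_lift:
  assumes "closed_space V" "closed_space X"
    and l: "\<And>x. x \<in> carr X \<Longrightarrow> (\<lambda>v. \<beta> v x) \<in> Hom V W"
    and r: "\<And>v. v \<in> carr V \<Longrightarrow> \<beta> v \<in> Hom X W"
  shows tensor_lift_Hom: "tensor_lift V X W \<beta> \<in> Hom (V \<otimes> X) W"
    and tensor_lift_pure:
      "\<And>v x. v \<in> carr V \<Longrightarrow> x \<in> carr X \<Longrightarrow> tensor_lift V X W \<beta> (pure_tensor V X v x) = \<beta> v x"
proof -
  have ne: "carr V \<times> carr X \<noteq> {}" using assms(1,2) by (auto simp: closed_space_def)
  have comp: "compatible W (carr V \<times> carr X) (\<lambda>(v, x). \<beta> v x) q" if "q \<in> bilinear_rels V X" for q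
    using that assms(1,2) l r unfolding bilinear_rels_def
    by (elim UnE UN_E) (erule compatible_linear_rels[rotated 3]; simp)+
  have carr: "(\<lambda>(v, x). \<beta> v x) p \<in> carr W" if "p \<in> carr V \<times> carr X" for p
    using that by (auto intro: Hom_carr[OF l])
  have pure: "(\<lambda>(v, x). pure_tensor V X v x) p = gen p +o free_span (bilinear_rels V X)" for p
    by (auto simp: pure_tensor_def)
  show "tensor_lift V X W \<beta> \<in> Hom (V \<otimes> X) W"
    unfolding tensor_lift_def tensor_eq_quot 
    by (rule linear_ext_quot(1)[OF ne], erule carr, erule comp, rule pure)
  show "tensor_lift V X W \<beta> (pure_tensor V X v x) = \<beta> v x" if "v \<in> carr V" "x \<in> carr X" for v x
    using linear_ext_quot(2)[OF ne carr comp pure, of "(v, x)"] that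
    unfolding tensor_lift_def tensor_eq_quot by simp
qed

lemma Hom_tensor_eqI:
  assumes "f \<in> Hom (V \<otimes> X) W" "f' \<in> Hom (V \<otimes> X) W" "closed_space V" "closed_space X"
    "\<And>v x. v \<in> carr V \<Longrightarrow> x \<in> carr X \<Longrightarrow> f (pure_tensor V X v x) = f' (pure_tensor V X v x)"
  shows "f = f'"
proof (rule Hom_quot_eqI)
  show "carr V \<times> carr X \<noteq> {}" using assms(3,4) by (auto simp: closed_space_def)
  show "f (gen p +o free_span (bilinear_rels V X)) = f' (gen p +o free_span (bilinear_rels V X))"
    if "p \<in> carr V \<times> carr X" for p
    using that assms(5) by (auto simp: pure_tensor_def)
qed (use assms in \<open>simp_all add: tensor_eq_quot\<close>)

section \<open>Multilinear maps and tensor powers\<close>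

text \<open>Constrains \<open>h\<close> on lists of length \<open>n\<close> only, so functions on
  all lists can be used without cutting down their domain.\<close>

definition multilinear ::
  "('k \<Rightarrow> 'a::plus \<Rightarrow> 'a) \<Rightarrow> ('k \<Rightarrow> 'm::{plus,zero} \<Rightarrow> 'm) \<Rightarrow> nat \<Rightarrow> ('a list \<Rightarrow> 'm) \<Rightarrow> bool" where
  "multilinear s t n h \<longleftrightarrow>
     (\<forall>xs ys. Suc (length xs + length ys) = n \<longrightarrow> (\<lambda>v. h (xs @ v # ys)) \<in> Hom (vs s) (vs t))"

lemma multilinear_0 [simp]: "multilinear s t 0 h"
  by (simp add: multilinear_def)

text \<open>Splitting off the first slot gives the recursion behind the inductions for
  \<open>contract\<close> and \<open>butlast\<close> below.\<close>

lemma multilinear_Suc: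
  "multilinear s t (Suc n) h \<longleftrightarrow>
     (\<forall>x. multilinear s t n (\<lambda>xs. h (x # xs))) \<and>
     (\<forall>ys. length ys = n \<longrightarrow> (\<lambda>v. h (v # ys)) \<in> Hom (vs s) (vs t))" (is "?l \<longleftrightarrow> ?r")
proof
  assume l: ?l
  have "(\<lambda>v. h (x # xs @ v # ys)) \<in> Hom (vs s) (vs t)" if "Suc (length xs + length ys) = n" for x xs ys
    using l[unfolded multilinear_def, rule_format, of "x # xs" ys] that by simp
  moreover have "(\<lambda>v. h (v # ys)) \<in> Hom (vs s) (vs t)" if "length ys = n" for ys
    using l[unfolded multilinear_def, rule_format, of "[]" ys] that by simp
  ultimately show ?r by (simp add: multilinear_def)
next
  assume ?r
  then show ?l
    unfolding multilinear_def by (intro allI impI, case_tac xs) auto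
qed

lemma words_nonempty [simp]: "words (UNIV :: 'v::zero set) n \<noteq> {}"
proof -
  have "replicate n (0::'v) \<in> words UNIV n" by (simp add: words_def)
  then show ?thesis by blast
qed

lemma words_UNIV [simp]: "xs \<in> words UNIV n \<longleftrightarrow> length xs = n"
  by (simp add: words_def)

lemma tensor_power_eq_quot: "tensor_power V n = quot (words (carr V) n) (multilinear_rels V n)"
  by (simp add: tensor_power_def)

lemma closed_space_tensor_power:
  "closed_space (tensor_power (vs s :: ('k::field, 'v::ab_group_add) kspace) n)"
  unfolding tensor_power_eq_quot by (rule closed_space_quot) simp

lemma pure_power_carr [simp]: "length as = n \<Longrightarrow> pure_power (vs s) n as \<in> carr (tensor_power (vs s) n)"
  unfolding pure_power_def tensor_power_eq_quot by (rule gen_in_quot) simp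

lemma pure_power_multilinear:
  assumes "Suc (length xs + length ys) = n"
  shows "pure_power (vs s) n (xs @ (u + v) # ys) = pure_power (vs s) n (xs @ u # ys) + pure_power (vs s) n (xs @ v # ys)"
    and "pure_power (vs s) n (xs @ s r u # ys) = scal (tensor_power (vs s) n) r (pure_power (vs s) n (xs @ u # ys))"
proof -
  have "linear_rels (vs s) (\<lambda>v. xs @ v # ys) \<subseteq> multilinear_rels (vs s) n"
    using assms unfolding multilinear_rels_def by (fastforce simp: words_def)
  from linear_rels_coset[OF this]
  show "pure_power (vs s) n (xs @ (u + v) # ys) = pure_power (vs s) n (xs @ u # ys) + pure_power (vs s) n (xs @ v # ys)"
    "pure_power (vs s) n (xs @ s r u # ys) = scal (tensor_power (vs s) n) r (pure_power (vs s) n (xs @ u # ys))"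
    unfolding pure_power_def tensor_power_eq_quot by auto
qed

lemma chain_elem_eq:
  "length as = n \<Longrightarrow>
    chain_elem sA sC c as = pure_tensor (vs sC) (tensor_power (vs sA) n) c (pure_power (vs sA) n as)"
  by (auto simp: chain_elem_def)

lemma Hom_chain_elem:
  fixes sA :: "'k::field \<Rightarrow> 'a::{ring,monoid_mult} \<Rightarrow> 'a"
  assumes f: "f \<in> Hom (vs sC \<otimes> tensor_power (vs sA) n) (vs sM)"
  shows multilinear_chain_elem: "multilinear sA sM n (\<lambda>as. f (chain_elem sA sC c as))"
    and linear_chain_elem: "length as = n \<Longrightarrow> (\<lambda>c. f (chain_elem sA sC c as)) \<in> Hom (vs sC) (vs sM)"
proof -
  let ?P = "tensor_power (vs sA) n"
  have [simp]: "f (x + y) = f x + f y" "f (scal (vs sC \<otimes> ?P) r x) = sM r (f x)"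
    if "x \<in> carr (vs sC \<otimes> ?P)" "y \<in> carr (vs sC \<otimes> ?P)" for x y r
    using Hom_add[OF f that] Hom_scal[OF f that(1)] by simp_all
  show "multilinear sA sM n (\<lambda>as. f (chain_elem sA sC c as))"
    by (auto simp: multilinear_def Hom_vs_iff chain_elem_eq[where n = n] pure_power_multilinear
        pure_tensor_right pure_tensor_carr Hom_scal[OF f])
  show "(\<lambda>c. f (chain_elem sA sC c as)) \<in> Hom (vs sC) (vs sM)" if "length as = n"
    using that by (auto simp: Hom_vs_iff chain_elem_eq[where n = n] pure_tensor_carr Hom_scal[OF f]
        pure_tensor_left(1) pure_tensor_left(2)[where V = "vs sC", simplified])
qed

text \<open>Uniqueness in two layers: pure tensors of the outer product reduce the claim to c
  \<otimes> x, and induction on x in A^n reduces it further to pure powers.\<close>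

lemma Hom_chain_eqI:
  fixes sA :: "'k::field \<Rightarrow> 'a::{ring,monoid_mult} \<Rightarrow> 'a"
  assumes f: "f \<in> Hom (vs sC \<otimes> tensor_power (vs sA) n) (vs sM)"
    and f': "f' \<in> Hom (vs sC \<otimes> tensor_power (vs sA) n) (vs sM)"
    and eq: "\<And>c as. length as = n \<Longrightarrow> f (chain_elem sA sC c as) = f' (chain_elem sA sC c as)"
  shows "f = f'"
proof (rule Hom_tensor_eqI[OF f f'])
  fix c x assume "x \<in> carr (tensor_power (vs sA) n)"
  then have x: "x \<in> carr (quot (words UNIV n) (multilinear_rels (vs sA) n))"
    by (simp add: tensor_power_eq_quot)
  show "f (pure_tensor (vs sC) (tensor_power (vs sA) n) c x) = f' (pure_tensor (vs sC) (tensor_power (vs sA) n) c x)"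
    using x words_nonempty
  proof (induction rule: quot_induct)
    case (gen p)
    then show ?case using eq[of p c] by (simp add: chain_elem_eq[where n = n] pure_power_def)
  next
    case (add X Y)
    then show ?case
      by (simp add: tensor_power_eq_quot pure_tensor_right pure_tensor_carr
          Hom_add[OF f[unfolded tensor_power_eq_quot]] Hom_add[OF f'[unfolded tensor_power_eq_quot]])
  next
    case (scal r X)
    then show ?case
      by (simp add: tensor_power_eq_quot pure_tensor_right pure_tensor_carr
          Hom_scal[OF f[unfolded tensor_power_eq_quot carr_vs]]
          Hom_scal[OF f'[unfolded tensor_power_eq_quot carr_vs]])
  qed
qed (simp_all add: closed_space_tensor_power)

text \<open>The elements \<open>chain_elem\<close> are fewer than the generators of the outer
  quotient, so \<open>linear_ext_quot\<close> does not apply at once. First \<open>c\<close> is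
  fixed and \<open>g c\<close> is extended over A^n to \<open>t c\<close>; then the pair is extended
  over C \<otimes> A^n. \<open>Hom_chain_eqI\<close> identifies the result with
  \<open>F\<close>.\<close>

lemma chain_lift:
  fixes sA :: "'k::field \<Rightarrow> 'a::{ring,monoid_mult} \<Rightarrow> 'a"
    and sC :: "'k \<Rightarrow> 'c::ab_group_add \<Rightarrow> 'c" and sM :: "'k \<Rightarrow> 'm::ab_group_add \<Rightarrow> 'm"
  assumes M: "vector_space sM"
    and lin: "\<And>as. length as = n \<Longrightarrow> (\<lambda>c. g c as) \<in> Hom (vs sC) (vs sM)"
    and multi: "\<And>c. multilinear sA sM n (g c)"
  defines "F \<equiv> linear_ext (vs sC \<otimes> tensor_power (vs sA) n) (vs sM) (UNIV \<times> words UNIV n)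
       (\<lambda>(c, as). chain_elem sA sC c as) (\<lambda>(c, as). g c as)"
  shows "F \<in> Hom (vs sC \<otimes> tensor_power (vs sA) n) (vs sM)"
    and "\<And>c as. length as = n \<Longrightarrow> F (chain_elem sA sC c as) = g c as"
proof -
  interpret M: linear_image sM "vs sM" id by (rule linear_image_vs[OF M])
  let ?R = "multilinear_rels (vs sA) n"
  define t where "t c = linear_ext (quot (words UNIV n) ?R) (vs sM) (words UNIV n)
    (\<lambda>as. pure_power (vs sA) n as) (g c)" for c
  have comp: "compatible (vs sM) (words UNIV n) (g c) q" if q: "q \<in> ?R" for q c
  proof -
    obtain xs ys where "q \<in> linear_rels (vs sA) (\<lambda>v. xs @ v # ys)" "Suc (length xs + length ys) = n"
      using q unfolding multilinear_rels_def by auto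
    then show ?thesis
      using multi[of c] by (intro compatible_linear_rels[where V = "vs sA"]) (auto simp: multilinear_def)
  qed
  have t: "t c \<in> Hom (quot (words UNIV n) ?R) (vs sM)"
    "length as = n \<Longrightarrow> t c (gen as +o free_span ?R) = g c as" for c as
    using M.linear_ext_quot[OF words_nonempty _ comp, where p = "pure_power (vs sA) n"]
    unfolding t_def by (simp_all add: pure_power_def)
  \<comment> \<open>\<open>t c\<close> is built for each \<open>c\<close> separately, so linearity
    in \<open>c\<close> is known on pure powers only and has to be propagated to every
    \<open>x\<close>.\<close>
  have tl: "(\<lambda>c. t c x) \<in> Hom (vs sC) (vs sM)" if "x \<in> carr (quot (words UNIV n) ?R)" for x
    using that words_nonempty
  proof (induction rule: quot_induct)
    case (gen p)
    then show ?case using lin by (simp add: t)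
  next
    case (add X Y)
    then show ?case
      using Hom_add[OF t(1)] by (simp add: Hom_vs_iff M.scale_right_distrib add_ac)
  next
    case (scal r X)
    then show ?case
      using Hom_scal[OF t(1)] by (simp add: Hom_vs_iff M.scale_right_distrib mult.commute)
  qed
  have closed: "closed_space (quot (words UNIV n) ?R)"
    by (simp add: closed_space_quot)
  define F0 where "F0 = tensor_lift (vs sC) (tensor_power (vs sA) n) (vs sM) t"
  have F0: "F0 \<in> Hom (vs sC \<otimes> tensor_power (vs sA) n) (vs sM)"
    unfolding F0_def by (rule M.tensor_lift_Hom) (use t(1) tl closed in \<open>simp_all add: tensor_power_eq_quot\<close>)
  have F0v: "F0 (chain_elem sA sC c as) = g c as" if "length as = n" for c as
  proof -
    have "F0 (chain_elem sA sC c as) = t c (pure_power (vs sA) n as)"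
      unfolding F0_def chain_elem_eq[OF that]
      by (rule M.tensor_lift_pure) (use t(1) tl closed pure_power_carr[OF that, of sA] in \<open>simp_all add: tensor_power_eq_quot\<close>)
    then show ?thesis using t(2)[OF that] by (simp add: pure_power_def)
  qed
  have "F = F0"
    unfolding F_def linear_ext_def
    by (rule the_equality) (use F0 F0v in \<open>auto intro!: Hom_chain_eqI[OF _ F0]\<close>)
  then show "F \<in> Hom (vs sC \<otimes> tensor_power (vs sA) n) (vs sM)"
    and "\<And>c as. length as = n \<Longrightarrow> F (chain_elem sA sC c as) = g c as"
    using F0 F0v by simp_all
qed

section \<open>The tensor product over a subset of the algebra\<close>

lemma tensor_over_eq_quot: "tensor_over sA B = quot UNIV (balanced_rels sA B)"
  by (simp add: tensor_over_def)

lemma pure_over_carr [simp]: "pure_over sA B a a' \<in> carr (tensor_over sA B)"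
  unfolding pure_over_def tensor_over_eq_quot by (rule gen_in_quot) simp

lemma pure_over_left:
  "pure_over sA B (a + b) c = pure_over sA B a c + pure_over sA B b c"
  "pure_over sA B (sA r a) c = scal (tensor_over sA B) r (pure_over sA B a c)"
proof -
  have "linear_rels (vs sA) (\<lambda>v. (v, c)) \<subseteq> balanced_rels sA B"
    by (auto simp: balanced_rels_def bilinear_rels_def)
  from linear_rels_coset[OF this]
  show "pure_over sA B (a + b) c = pure_over sA B a c + pure_over sA B b c"
    "pure_over sA B (sA r a) c = scal (tensor_over sA B) r (pure_over sA B a c)"
    unfolding pure_over_def tensor_over_eq_quot by auto
qed

lemma pure_over_right:
  "pure_over sA B c (a + b) = pure_over sA B c a + pure_over sA B c b"
  "pure_over sA B c (sA r a) = scal (tensor_over sA B) r (pure_over sA B c a)"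
proof -
  have "linear_rels (vs sA) (\<lambda>v. (c, v)) \<subseteq> balanced_rels sA B"
    by (auto simp: balanced_rels_def bilinear_rels_def)
  from linear_rels_coset[OF this]
  show "pure_over sA B c (a + b) = pure_over sA B c a + pure_over sA B c b"
    "pure_over sA B c (sA r a) = scal (tensor_over sA B) r (pure_over sA B c a)"
    unfolding pure_over_def tensor_over_eq_quot by auto
qed

lemma pure_over_balanced:
  assumes "b \<in> B"
  shows "pure_over sA B (a * b) a' = pure_over sA B a (b * a')"
proof -
  have "gen (a * b, a') - gen (a, b * a') \<in> balanced_rels sA B"
    using assms unfolding balanced_rels_def by blast
  then show ?thesis
    by (simp add: pure_over_def coset_eq_iff) (simp add: free_span_def free.span_base)
qed

lemma (in linear_image) over_lift:
  assumes l: "\<And>y. (\<lambda>x. \<beta> x y) \<in> Hom (vs sA) W" and r: "\<And>x. \<beta> x \<in> Hom (vs sA) W"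
    and bal: "\<And>x b y. b \<in> B \<Longrightarrow> \<beta> (x * b) y = \<beta> x (b * y)"
  defines "F \<equiv> linear_ext (tensor_over sA B) W UNIV (\<lambda>(a, a'). pure_over sA B a a') (\<lambda>(a, a'). \<beta> a a')"
  shows "F \<in> Hom (tensor_over sA B) W" and "\<And>x y. F (pure_over sA B x y) = \<beta> x y"
proof -
  have comp: "compatible W UNIV (\<lambda>(v, x). \<beta> v x) q" if q: "q \<in> balanced_rels sA B" for q
  proof -
    consider "q \<in> bilinear_rels (vs sA) (vs sA)"
      | a b a' where "b \<in> B" "q = gen (a * b, a') - gen (a, b * a')"
      using q unfolding balanced_rels_def by auto
    then show ?thesis
    proof cases
      case 1
      then show ?thesis using l r unfolding bilinear_rels_def
        by (elim UnE UN_E) (erule compatible_linear_rels[rotated 3]; simp)+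
    next
      case 2
      then show ?thesis using bal[of b a a'] unfolding compatible_def by fastforce
    qed
  qed
  have c: "\<beta> x y \<in> carr W" for x y using Hom_carr[OF r] by simp
  have carr: "(\<lambda>(v, x). \<beta> v x) p \<in> carr W" for p
    by (cases p) (simp add: c)
  have pure: "(\<lambda>(v, x). pure_over sA B v x) p = gen p +o free_span (balanced_rels sA B)" for p
    by (auto simp: pure_over_def)
  show "F \<in> Hom (tensor_over sA B) W"
    unfolding F_def tensor_over_eq_quot 
    by (rule linear_ext_quot(1)[OF UNIV_not_empty], rule carr, erule comp, rule pure)
  show "F (pure_over sA B x y) = \<beta> x y" for x y
    using linear_ext_quot(2)[OF UNIV_not_empty carr comp pure, of "(x, y)"]
    unfolding F_def tensor_over_eq_quot by simp
qed

section \<open>Vector space laws for cosets and induction over pure tensors\<close>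

lemma (in linear_image) scal_add:
  assumes "x \<in> carr W" "y \<in> carr W"
  shows "scal W r (x + y) = scal W r x + scal W r y"
proof -
  obtain u v where "x = \<pi> u" "y = \<pi> v" using assms range_image by (metis imageE)
  then show ?thesis by (simp add: image_add[symmetric] image_scale[symmetric] scale_right_distrib)
qed

lemma (in linear_image) scal_scal:
  assumes "x \<in> carr W"
  shows "scal W r (scal W q x) = scal W (r * q) x"
proof -
  obtain u where "x = \<pi> u" using assms range_image by (metis imageE)
  then show ?thesis by (simp add: image_scale[symmetric])
qed

lemma linear_image_tensor_vs:
  "linear_image free_scale (vs s \<otimes> vs t) (\<lambda>x. x +o free_span (bilinear_rels (vs s) (vs t)))"
  using linear_image_quot[of "bilinear_rels (vs s) (vs t)"] by (simp add: tensor_eq_quot)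

lemma linear_image_tensor_over:
  "linear_image free_scale (tensor_over sA B) (\<lambda>x. x +o free_span (balanced_rels sA B))"
  by (simp add: tensor_over_eq_quot linear_image_quot)

lemma tensor_vs_induct [consumes 1, case_names pure add scal]:
  assumes "t \<in> carr (vs s \<otimes> vs s')"
    and "\<And>a c. P (pure_tensor (vs s) (vs s') a c)"
    and "\<And>t u. \<lbrakk>t \<in> carr (vs s \<otimes> vs s'); u \<in> carr (vs s \<otimes> vs s'); P t; P u\<rbrakk> \<Longrightarrow> P (t + u)"
    and "\<And>r t. \<lbrakk>t \<in> carr (vs s \<otimes> vs s'); P t\<rbrakk> \<Longrightarrow> P (scal (vs s \<otimes> vs s') r t)"
  shows "P t"
proof -
  have "t \<in> carr (quot UNIV (bilinear_rels (vs s) (vs s')))"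
    using assms(1) by (simp add: tensor_eq_quot)
  then show ?thesis using UNIV_not_empty
    by (induction rule: quot_induct)
      (use assms(2-) in \<open>auto simp: tensor_eq_quot pure_tensor_def\<close>)
qed

lemma tensor_over_induct [consumes 1, case_names pure add scal]:
  assumes "t \<in> carr (tensor_over sA B)"
    and "\<And>x y. P (pure_over sA B x y)"
    and "\<And>t u. \<lbrakk>t \<in> carr (tensor_over sA B); u \<in> carr (tensor_over sA B); P t; P u\<rbrakk> \<Longrightarrow> P (t + u)"
    and "\<And>r t. \<lbrakk>t \<in> carr (tensor_over sA B); P t\<rbrakk> \<Longrightarrow> P (scal (tensor_over sA B) r t)"
  shows "P t"
proof -
  have "t \<in> carr (quot UNIV (balanced_rels sA B))"
    using assms(1) by (simp add: tensor_over_eq_quot)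
  then show ?thesis using UNIV_not_empty
    by (induction rule: quot_induct)
      (use assms(2-) in \<open>auto simp: tensor_over_eq_quot pure_over_def\<close>)
qed

section \<open>The canonical map and the canonical entwining\<close>

context galois_extension
begin

abbreviation "B \<equiv> coinvariants sA sC \<rho>"
abbreviation "AC \<equiv> vs sA \<otimes> vs sC"
abbreviation "AA \<equiv> tensor_over sA B"
abbreviation "pure \<equiv> pure_tensor (vs sA) (vs sC)"
abbreviation "over \<equiv> pure_over sA B"

sublocale AC: linear_image free_scale AC "\<lambda>x. x +o free_span (bilinear_rels (vs sA) (vs sC))"
  by (rule linear_image_tensor_vs)

sublocale AA: linear_image free_scale AA "\<lambda>x. x +o free_span (balanced_rels sA B)"
  by (rule linear_image_tensor_over)

lemma AC_add_closed [simp]: "t \<in> carr AC \<Longrightarrow> u \<in> carr AC \<Longrightarrow> t + u \<in> carr AC"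
  and AC_scal_closed [simp]: "t \<in> carr AC \<Longrightarrow> scal AC r t \<in> carr AC"
  using closed_space_tensor[of "vs sA" "vs sC"] by (auto simp: closed_space_def)

lemma AA_add_closed [simp]: "t \<in> carr AA \<Longrightarrow> u \<in> carr AA \<Longrightarrow> t + u \<in> carr AA"
  and AA_scal_closed [simp]: "t \<in> carr AA \<Longrightarrow> scal AA r t \<in> carr AA"
  by (simp_all only: tensor_over_eq_quot quot_add_closed quot_scal_closed)

lemma pure_carr [simp]: "pure a c \<in> carr AC"
  by (simp add: pure_tensor_carr)

lemma pure_linear:
  "pure (a + b) c = pure a c + pure b c" "pure (sA r a) c = scal AC r (pure a c)"
  "pure a (c + d) = pure a c + pure a d" "pure a (sC r c) = scal AC r (pure a c)"
  using pure_tensor_left[of c "vs sC" a "vs sA"] pure_tensor_right[of a "vs sA" c "vs sC"] by simp_all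

lemma coact_carr [simp]: "\<rho> a \<in> carr AC"
  and coact_add: "\<rho> (a + b) = \<rho> a + \<rho> b"
  and coact_scale: "\<rho> (sA r a) = scal AC r (\<rho> a)"
  using coact_hom by (auto simp: Hom_vs_iff)

lemma left_mult_Hom: "left_mult sA sC a \<in> Hom AC AC"
  and left_mult_pure [simp]: "left_mult sA sC a (pure a' c) = pure (a * a') c"
proof -
  have l: "(\<lambda>a'. pure (a * a') c) \<in> Hom (vs sA) AC" for c
    by (simp add: Hom_vs_iff distrib_left pure_linear scale_mult_right)
  have r: "pure (a * a') \<in> Hom (vs sC) AC" for a'
    by (simp add: Hom_vs_iff pure_linear)
  show "left_mult sA sC a \<in> Hom AC AC"
    using AC.tensor_lift_Hom[OF closed_space_vs closed_space_vs l r]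
    by (simp add: left_mult_def[abs_def])
  show "left_mult sA sC a (pure a' c) = pure (a * a') c"
    using AC.tensor_lift_pure[OF closed_space_vs closed_space_vs l r]
    by (simp add: left_mult_def)
qed

lemmas left_mult_add = Hom_add[OF left_mult_Hom]
  and left_mult_scal = Hom_scal[OF left_mult_Hom]
  and left_mult_carr [simp] = Hom_carr[OF left_mult_Hom]

lemma left_mult_linear:
  assumes "t \<in> carr AC"
  shows "(\<lambda>a. left_mult sA sC a t) \<in> Hom (vs sA) AC"
  using assms
proof (induction rule: tensor_vs_induct)
  case (pure a c)
  then show ?case by (simp add: Hom_vs_iff distrib_right pure_linear scale_mult_left)
next
  case (add t u)
  then show ?case by (simp add: Hom_vs_iff left_mult_add AC.scal_add add_ac)
next
  case (scal r t)
  then show ?case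
    by (simp add: Hom_vs_iff left_mult_scal AC.scal_add AC.scal_scal mult.commute)
qed

lemma left_mult_mult:
  assumes "t \<in> carr AC"
  shows "left_mult sA sC (a * b) t = left_mult sA sC a (left_mult sA sC b t)"
  using assms
  by (induction rule: tensor_vs_induct) (simp_all add: left_mult_add left_mult_scal mult.assoc)

lemma left_mult_one:
  assumes "t \<in> carr AC"
  shows "left_mult sA sC 1 t = t"
  using assms
  by (induction rule: tensor_vs_induct) (simp_all add: left_mult_add left_mult_scal)

lemma coact_coinvariant: "b \<in> B \<Longrightarrow> \<rho> (b * a) = left_mult sA sC b (\<rho> a)"
  by (simp add: coinvariants_def)

text \<open>Well definedness over \<open>B\<close> is the defining property of the coinvariants:
  \<open>b\<close> may be pulled out of \<open>\<rho> (b * y)\<close> and then multiplied onto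
  \<open>x\<close>.\<close>

lemma can_Hom: "can sA sC \<rho> \<in> Hom AA AC"
  and can_over [simp]: "can sA sC \<rho> (over a a') = left_mult sA sC a (\<rho> a')"
proof -
  have r: "(\<lambda>a'. left_mult sA sC a (\<rho> a')) \<in> Hom (vs sA) AC" for a
    by (simp add: Hom_vs_iff coact_add coact_scale left_mult_add left_mult_scal)
  have l: "(\<lambda>a. left_mult sA sC a (\<rho> a')) \<in> Hom (vs sA) AC" for a'
    by (simp add: left_mult_linear)
  have b: "left_mult sA sC (x * b) (\<rho> y) = left_mult sA sC x (\<rho> (b * y))" if "b \<in> B" for x b y
    using that by (simp add: left_mult_mult coact_coinvariant)
  show "can sA sC \<rho> \<in> Hom AA AC" "can sA sC \<rho> (over a a') = left_mult sA sC a (\<rho> a')"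
    using AC.over_lift[OF l r b] by (simp_all add: can_def)
qed

lemmas can_add = Hom_add[OF can_Hom]
  and can_scal = Hom_scal[OF can_Hom]
  and can_carr [simp] = Hom_carr[OF can_Hom]

section \<open>The inverse of the canonical map and the translation map\<close>

definition can_inv :: "('a \<times> 'c \<Rightarrow>\<^sub>0 'k) set \<Rightarrow> ('a \<times> 'a \<Rightarrow>\<^sub>0 'k) set" where
  "can_inv = inv_into (carr AA) (can sA sC \<rho>)"

lemma can_inv_carr [simp]: "t \<in> carr AC \<Longrightarrow> can_inv t \<in> carr AA"
  and can_can_inv [simp]: "t \<in> carr AC \<Longrightarrow> can sA sC \<rho> (can_inv t) = t"
  using can_bij by (auto simp: can_inv_def bij_betw_def inv_into_into f_inv_into_f)

lemma can_inv_can [simp]: "t \<in> carr AA \<Longrightarrow> can_inv (can sA sC \<rho> t) = t"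
  using can_bij by (auto simp: can_inv_def bij_betw_def inv_into_f_f)

lemma can_inv_add: "t \<in> carr AC \<Longrightarrow> u \<in> carr AC \<Longrightarrow> can_inv (t + u) = can_inv t + can_inv u"
  using can_inv_can[of "can_inv t + can_inv u"] by (simp add: can_add)

lemma can_inv_scal: "t \<in> carr AC \<Longrightarrow> can_inv (scal AC r t) = scal AA r (can_inv t)"
  using can_inv_can[of "scal AA r (can_inv t)"] by (simp add: can_scal)

text \<open>The translation map of the Galois extension; it supplies the elements x_i and y_i in the
  formula for the inverse correspondence.\<close>

definition translation :: "'c \<Rightarrow> ('a \<times> 'a \<Rightarrow>\<^sub>0 'k) set" where
  "translation c = can_inv (pure 1 c)"

lemma translation_carr [simp]: "translation c \<in> carr AA"
  and can_translation [simp]: "can sA sC \<rho> (translation c) = pure 1 c"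
  by (simp_all add: translation_def)

lemma translation_add: "translation (c + d) = translation c + translation d"
  and translation_scale: "translation (sC r c) = scal AA r (translation c)"
  by (simp_all add: translation_def pure_linear can_inv_add can_inv_scal)

lemma over_linear:
  "over (a + b) c = over a c + over b c" "over (sA r a) c = scal AA r (over a c)"
  "over c (a + b) = over c a + over c b" "over c (sA r a) = scal AA r (over c a)"
  by (simp_all add: pure_over_left pure_over_right)

text \<open>The left A-action on A \<otimes>_B A. With it \<open>can\<close> becomes left A-linear,
  so \<open>can_inv\<close> is determined by its values on 1 \<otimes> c, that is by
  \<open>translation\<close>.\<close>

definition left_over :: "'a \<Rightarrow> ('a \<times> 'a \<Rightarrow>\<^sub>0 'k) set \<Rightarrow> ('a \<times> 'a \<Rightarrow>\<^sub>0 'k) set" where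
  "left_over a = linear_ext AA AA UNIV (\<lambda>(x, y). over x y) (\<lambda>(x, y). over (a * x) y)"

lemma left_over_Hom: "left_over a \<in> Hom AA AA"
  and left_over_over [simp]: "left_over a (over x y) = over (a * x) y"
proof -
  have l: "(\<lambda>x. over (a * x) y) \<in> Hom (vs sA) AA" for y
    by (simp add: Hom_vs_iff distrib_left over_linear scale_mult_right)
  have r: "over (a * x) \<in> Hom (vs sA) AA" for x
    by (simp add: Hom_vs_iff over_linear)
  have b: "over (a * (x * b)) y = over (a * x) (b * y)" if "b \<in> B" for x b y
    using pure_over_balanced[OF that] by (simp add: mult.assoc[symmetric])
  show "left_over a \<in> Hom AA AA" "left_over a (over x y) = over (a * x) y"
    using AA.over_lift[OF l r b] by (simp_all add: left_over_def)
qed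

lemmas left_over_add = Hom_add[OF left_over_Hom]
  and left_over_scal = Hom_scal[OF left_over_Hom]
  and left_over_carr [simp] = Hom_carr[OF left_over_Hom]

lemma can_left_over:
  assumes "t \<in> carr AA"
  shows "can sA sC \<rho> (left_over a t) = left_mult sA sC a (can sA sC \<rho> t)"
  using assms
  by (induction rule: tensor_over_induct)
    (simp_all add: left_over_add left_over_scal can_add can_scal left_mult_add left_mult_scal left_mult_mult)

lemma can_inv_pure: "can_inv (pure a c) = left_over a (translation c)"
  using can_inv_can[of "left_over a (translation c)"] by (simp add: can_left_over)

lemma right_mult_Hom: "(\<lambda>t. right_mult sA B t a) \<in> Hom AA AA"
  and right_mult_over [simp]: "right_mult sA B (over x y) a = over x (y * a)"
proof -
  have l: "(\<lambda>x. over x (y * a)) \<in> Hom (vs sA) AA" for y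
    by (simp add: Hom_vs_iff over_linear)
  have r: "(\<lambda>y. over x (y * a)) \<in> Hom (vs sA) AA" for x
    by (simp add: Hom_vs_iff distrib_right over_linear scale_mult_left)
  have b: "over (x * b) (y * a) = over x (b * y * a)" if "b \<in> B" for x b y
    using pure_over_balanced[OF that] by (simp add: mult.assoc)
  show "(\<lambda>t. right_mult sA B t a) \<in> Hom AA AA" "right_mult sA B (over x y) a = over x (y * a)"
    using AA.over_lift[OF l r b] by (simp_all add: right_mult_def)
qed

lemmas right_mult_add = Hom_add[OF right_mult_Hom]
  and right_mult_scal = Hom_scal[OF right_mult_Hom]
  and right_mult_carr [simp] = Hom_carr[OF right_mult_Hom]

lemma right_mult_linear:
  assumes "t \<in> carr AA"
  shows "(\<lambda>a. right_mult sA B t a) \<in> Hom (vs sA) AA"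
  using assms
proof (induction rule: tensor_over_induct)
  case (pure x y)
  then show ?case by (simp add: Hom_vs_iff distrib_left over_linear scale_mult_right)
next
  case (add t u)
  then show ?case by (simp add: Hom_vs_iff right_mult_add AA.scal_add add_ac)
next
  case (scal r t)
  then show ?case
    by (simp add: Hom_vs_iff right_mult_scal AA.scal_add AA.scal_scal mult.commute)
qed

section \<open>The canonical entwining\<close>

abbreviation "\<psi> \<equiv> canonical_entwining sA sC \<rho>"

text \<open>The entwining is given through \<open>tensor_lift\<close>, so its formula can be read
  off on pure tensors only after bilinearity in \<open>c\<close> and \<open>a\<close> is
  established.\<close>

lemma canonical_entwining_pure:
  "\<psi> (pure_tensor (vs sC) (vs sA) c a) = can sA sC \<rho> (right_mult sA B (translation c) a)"
proof -
  have l: "(\<lambda>c. can sA sC \<rho> (right_mult sA B (translation c) a)) \<in> Hom (vs sC) AC" for a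
    by (simp add: Hom_vs_iff translation_add translation_scale right_mult_add right_mult_scal can_add can_scal)
  have r: "(\<lambda>a. can sA sC \<rho> (right_mult sA B (translation c) a)) \<in> Hom (vs sA) AC" for c
    using right_mult_linear[OF translation_carr[of c]] by (simp add: Hom_vs_iff can_add can_scal)
  have eq: "\<psi> = tensor_lift (vs sC) (vs sA) AC (\<lambda>c a. can sA sC \<rho> (right_mult sA B (translation c) a))"
    by (simp add: canonical_entwining_def Let_def translation_def can_inv_def)
  show "\<psi> (pure_tensor (vs sC) (vs sA) c a) = can sA sC \<rho> (right_mult sA B (translation c) a)"
    unfolding eq using AC.tensor_lift_pure[OF closed_space_vs closed_space_vs l r] by simp
qed

lemma entwining_carr [simp]: "\<psi> (pure_tensor (vs sC) (vs sA) c a) \<in> carr AC"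
  by (simp add: canonical_entwining_pure)

lemma entwining_linear_right: "(\<lambda>a. \<psi> (pure_tensor (vs sC) (vs sA) c a)) \<in> Hom (vs sA) AC"
  using right_mult_linear[OF translation_carr[of c]]
  by (simp add: Hom_vs_iff canonical_entwining_pure can_add can_scal)

end

section \<open>Multilinear cochains\<close>

context
  fixes s :: "'k::field \<Rightarrow> 'v::ab_group_add \<Rightarrow> 'v" and t :: "'k \<Rightarrow> 'w::ab_group_add \<Rightarrow> 'w"
  assumes t: "vector_space t"
begin

interpretation vector_space t by (rule t)

lemma Hom_vs_add:
  "\<phi> \<in> Hom (vs s) (vs t) \<Longrightarrow> \<phi>' \<in> Hom (vs s) (vs t) \<Longrightarrow> (\<lambda>x. \<phi> x + \<phi>' x) \<in> Hom (vs s) (vs t)"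
  by (simp add: Hom_vs_iff scale_right_distrib)

lemma Hom_vs_zero: "(\<lambda>x. 0) \<in> Hom (vs s) (vs t)"
  by (simp add: Hom_vs_iff)

lemma Hom_vs_scale: "\<phi> \<in> Hom (vs s) (vs t) \<Longrightarrow> (\<lambda>x. t r (\<phi> x)) \<in> Hom (vs s) (vs t)"
  by (simp add: Hom_vs_iff scale_right_distrib mult.commute)

lemma Hom_vs_sum:
  "(\<And>i. i \<in> I \<Longrightarrow> \<phi> i \<in> Hom (vs s) (vs t)) \<Longrightarrow> (\<lambda>x. \<Sum>i\<in>I. \<phi> i x) \<in> Hom (vs s) (vs t)"
  by (simp add: Hom_vs_iff scale_sum_right sum.distrib)

lemma multilinear_add:
  "multilinear s t n g \<Longrightarrow> multilinear s t n h \<Longrightarrow> multilinear s t n (\<lambda>xs. g xs + h xs)"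
  by (simp add: multilinear_def Hom_vs_add)

lemma multilinear_scale: "multilinear s t n h \<Longrightarrow> multilinear s t n (\<lambda>xs. t r (h xs))"
  by (simp add: multilinear_def Hom_vs_scale)

lemma multilinear_sum:
  "(\<And>i. i \<in> I \<Longrightarrow> multilinear s t n (h i)) \<Longrightarrow> multilinear s t n (\<lambda>xs. \<Sum>i\<in>I. h i xs)"
  by (simp add: multilinear_def Hom_vs_sum)

end

lemma contract_1: "contract (Suc 0) (x # y # zs) = (x * y) # zs"
  by (simp add: contract_def)

text \<open>At \<open>i = 0\<close> the truncated \<open>i - 1\<close> would multiply the head of
  \<open>xs\<close> by itself, hence the premise.\<close>

lemma contract_Suc: "0 < i \<Longrightarrow> contract (Suc i) (x # xs) = x # contract i xs"
  by (cases i) (simp_all add: contract_def)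

lemma length_contract: "0 < i \<Longrightarrow> i < length xs \<Longrightarrow> length (contract i xs) = length xs - 1"
  by (simp add: contract_def)

text \<open>Beyond position 1 the first entry is merely carried along, so the induction rests on
  position 1. There bilinearity of the product turns linearity of \<open>h\<close> in its first slot
  into linearity in the two merged slots.\<close>

lemma multilinear_contract:
  fixes h :: "'a::{ring,monoid_mult} list \<Rightarrow> 'm::ab_group_add"
  assumes A: "k_algebra sA" and h: "multilinear sA t n h" and i: "0 < i" "i \<le> n"
  shows "multilinear sA t (Suc n) (\<lambda>xs. h (contract i xs))"
  using h i
proof (induction i arbitrary: n h)
  case (Suc i)
  interpret k_algebra sA by (rule A)
  obtain m where n: "n = Suc m" using Suc.prems by (cases n) auto
  show ?case
  proof (cases "i = 0")
    case True
    have lin: "(\<lambda>v. h (v # ys)) \<in> Hom (vs sA) (vs t)" if "length ys = m" for ys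
      using Suc.prems(1) that by (simp add: n multilinear_Suc)
    have "multilinear sA t m (\<lambda>xs. h (x # xs))" for x
      using Suc.prems(1) by (simp add: n multilinear_Suc)
    moreover have "(\<lambda>v. h (contract (Suc 0) (v # ys))) \<in> Hom (vs sA) (vs t)" if ys: "length ys = Suc m" for ys
    proof -
      obtain y zs where "ys = y # zs" "length zs = m"
        using ys by (cases ys) auto
      then show ?thesis
        using lin[of zs] by (simp add: contract_1 Hom_vs_iff distrib_right scale_mult_left)
    qed
    moreover have "(\<lambda>v. h ((x * v) # ys)) \<in> Hom (vs sA) (vs t)" if "length ys = m" for x ys
      using lin[OF that] by (simp add: Hom_vs_iff distrib_left scale_mult_right)
    ultimately show ?thesis
      by (simp add: True n multilinear_Suc contract_1)
  next
    case False
    have "multilinear sA t (Suc m) (\<lambda>xs. h (x # contract i xs))" for x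
      using Suc.prems(1,3) False by (intro Suc.IH) (simp_all add: n multilinear_Suc)
    moreover have "(\<lambda>v. h (v # contract i ys)) \<in> Hom (vs sA) (vs t)" if "length ys = Suc m" for ys
      using Suc.prems(1,3) that False by (simp add: n multilinear_Suc length_contract)
    ultimately show ?thesis
      using False by (simp add: n multilinear_Suc[of _ _ "Suc m"] contract_Suc)
  qed
qed simp

lemma multilinear_ract_last:
  assumes M: "bimodule sA sM lact ract" and h: "multilinear sA sM n h"
  shows "multilinear sA sM (Suc n) (\<lambda>xs. ract (h (butlast xs)) (last xs))"
  using h
proof (induction n arbitrary: h)
  case 0
  interpret bimodule sA sM lact ract by (rule M)
  show ?case by (simp add: multilinear_Suc Hom_vs_iff ract_add_right ract_scale_right)
next
  case (Suc n)
  interpret bimodule sA sM lact ract by (rule M)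
  have "multilinear sA sM (Suc n) (\<lambda>xs. ract (h (x # butlast xs)) (last xs))" for x
    using Suc.prems by (intro Suc.IH) (simp add: multilinear_Suc)
  \<comment> \<open>The two functions may differ on the empty list, but multilinearity in degree
    \<open>Suc n\<close> never evaluates them there.\<close>
  then have "multilinear sA sM (Suc n) (\<lambda>xs. ract (h (butlast (x # xs))) (last (x # xs)))" for x
    by (rule back_subst[of "\<lambda>f. f"]) (auto simp: multilinear_def)
  moreover have "(\<lambda>v. ract (h (butlast (v # ys))) (last (v # ys))) \<in> Hom (vs sA) (vs sM)"
    if "length ys = Suc n" for ys
  proof -
    have "ys \<noteq> []" "(\<lambda>v. h (v # butlast ys)) \<in> Hom (vs sA) (vs sM)"
      using that Suc.prems by (auto simp: multilinear_Suc)
    then show ?thesis by (simp add: Hom_vs_iff ract_add_left ract_scale_left)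
  qed
  ultimately show ?case by (subst multilinear_Suc) blast
qed

section \<open>Evaluation with coefficients in a bimodule\<close>

locale galois_bimodule = galois_extension sA sC \<Delta> \<epsilon> \<rho> + bimodule sA sM lact ract
  for sA :: "'k::field \<Rightarrow> 'a::{ring,monoid_mult} \<Rightarrow> 'a"
    and sC :: "'k \<Rightarrow> 'c::ab_group_add \<Rightarrow> 'c"
    and \<Delta> :: "'c \<Rightarrow> ('c \<times> 'c \<Rightarrow>\<^sub>0 'k) set"
    and \<epsilon> :: "'c \<Rightarrow> 'k"
    and \<rho> :: "'a \<Rightarrow> ('a \<times> 'c \<Rightarrow>\<^sub>0 'k) set"
    and sM :: "'k \<Rightarrow> 'm::ab_group_add \<Rightarrow> 'm"
    and lact :: "'a \<Rightarrow> 'm \<Rightarrow> 'm"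
    and ract :: "'m \<Rightarrow> 'a \<Rightarrow> 'm"
begin

sublocale VM: linear_image sM "vs sM" id
  by (rule linear_image_vs) unfold_locales

abbreviation "CM \<equiv> Hom (vs sC) (vs sM)"

text \<open>The left A-linear extension of \<open>\<phi>\<close> to the free left A-module A
  \<otimes> C.\<close>

definition eval_C :: "('c \<Rightarrow> 'm) \<Rightarrow> ('a \<times> 'c \<Rightarrow>\<^sub>0 'k) set \<Rightarrow> 'm" where
  "eval_C \<phi> = tensor_lift (vs sA) (vs sC) (vs sM) (\<lambda>a c. lact a (\<phi> c))"

lemma eval_C_Hom: "\<phi> \<in> CM \<Longrightarrow> eval_C \<phi> \<in> Hom AC (vs sM)"
  and eval_C_pure: "\<phi> \<in> CM \<Longrightarrow> eval_C \<phi> (pure a c) = lact a (\<phi> c)"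
proof -
  assume \<phi>: "\<phi> \<in> CM"
  have l: "(\<lambda>a. lact a (\<phi> c)) \<in> Hom (vs sA) (vs sM)" for c
    by (simp add: Hom_vs_iff lact_add_left lact_scale_left)
  have r: "(\<lambda>c. lact a (\<phi> c)) \<in> CM" for a
    using \<phi> by (simp add: Hom_vs_iff lact_add_right lact_scale_right)
  show "eval_C \<phi> \<in> Hom AC (vs sM)" "eval_C \<phi> (pure a c) = lact a (\<phi> c)"
    using VM.tensor_lift[OF closed_space_vs closed_space_vs l r] by (simp_all add: eval_C_def)
qed

lemmas eval_C_add = Hom_add[OF eval_C_Hom]
  and eval_C_scal = Hom_scal[OF eval_C_Hom]

lemma lact_zero [simp]: "lact a 0 = 0"
  using lact_add_right[of a 0 0] by simp

lemma CM_add: "\<phi> \<in> CM \<Longrightarrow> \<phi>' \<in> CM \<Longrightarrow> (\<lambda>c. \<phi> c + \<phi>' c) \<in> CM"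
  and CM_scale: "\<phi> \<in> CM \<Longrightarrow> (\<lambda>c. sM r (\<phi> c)) \<in> CM"
  and CM_ract: "\<phi> \<in> CM \<Longrightarrow> (\<lambda>c. ract (\<phi> c) a) \<in> CM"
  and CM_zero: "(\<lambda>c. 0) \<in> CM"
  and CM_sum: "(\<And>i. i \<in> I \<Longrightarrow> \<phi>s i \<in> CM) \<Longrightarrow> (\<lambda>c. \<Sum>i\<in>I. \<phi>s i c) \<in> CM"
  using M.vector_space_axioms
  by (simp_all add: Hom_vs_add Hom_vs_scale Hom_vs_zero Hom_vs_sum)
    (simp add: Hom_vs_iff ract_add_left ract_scale_left)

lemma eval_C_fun:
  assumes "t \<in> carr AC" "\<phi> \<in> CM"
  shows eval_C_fun_add: "\<phi>' \<in> CM \<Longrightarrow> eval_C (\<lambda>c. \<phi> c + \<phi>' c) t = eval_C \<phi> t + eval_C \<phi>' t"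
    and eval_C_fun_scale: "eval_C (\<lambda>c. sM r (\<phi> c)) t = sM r (eval_C \<phi> t)"
    and eval_C_fun_ract: "eval_C (\<lambda>c. ract (\<phi> c) a) t = ract (eval_C \<phi> t) a"
    and eval_C_left_mult: "eval_C \<phi> (left_mult sA sC a t) = lact a (eval_C \<phi> t)"
proof -
  show "eval_C (\<lambda>c. \<phi> c + \<phi>' c) t = eval_C \<phi> t + eval_C \<phi>' t" if "\<phi>' \<in> CM"
    using assms(1)
    by (induction rule: tensor_vs_induct)
      (simp_all add: assms(2) that CM_add eval_C_pure eval_C_add eval_C_scal lact_add_right
        M.scale_right_distrib)
  show "eval_C (\<lambda>c. sM r (\<phi> c)) t = sM r (eval_C \<phi> t)"
    using assms(1)
    by (induction rule: tensor_vs_induct)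
      (simp_all add: assms(2) CM_scale eval_C_pure eval_C_add eval_C_scal lact_scale_right
        M.scale_right_distrib mult.commute)
  show "eval_C (\<lambda>c. ract (\<phi> c) a) t = ract (eval_C \<phi> t) a"
    using assms(1)
    by (induction rule: tensor_vs_induct)
      (simp_all add: assms(2) CM_ract eval_C_pure eval_C_add eval_C_scal lact_ract ract_add_left
        ract_scale_left)
  show "eval_C \<phi> (left_mult sA sC a t) = lact a (eval_C \<phi> t)"
    using assms(1)
    by (induction rule: tensor_vs_induct)
      (simp_all add: assms(2) eval_C_pure eval_C_add eval_C_scal lact_mult lact_add_right
        lact_scale_right left_mult_add left_mult_scal)
qed

lemma eval_C_fun_zero:
  assumes "t \<in> carr AC"
  shows "eval_C (\<lambda>c. 0) t = 0"
  using eval_C_fun_scale[OF assms CM_zero, of 0] by simp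

lemma eval_C_fun_sum:
  assumes "t \<in> carr AC" "finite I" "\<And>i. i \<in> I \<Longrightarrow> \<phi> i \<in> CM"
  shows "eval_C (\<lambda>c. \<Sum>i\<in>I. \<phi> i c) t = (\<Sum>i\<in>I. eval_C (\<phi> i) t)"
  using assms(2,3)
  by (induction I rule: finite_induct)
    (simp_all add: assms(1) eval_C_fun_zero eval_C_fun_add CM_sum)

definition left_linear :: "('a \<Rightarrow> 'm) \<Rightarrow> bool" where
  "left_linear G \<longleftrightarrow> G \<in> Hom (vs sA) (vs sM) \<and> (\<forall>b\<in>B. \<forall>y. G (b * y) = lact b (G y))"

definition eval_A :: "('a \<Rightarrow> 'm) \<Rightarrow> ('a \<times> 'a \<Rightarrow>\<^sub>0 'k) set \<Rightarrow> 'm" where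
  "eval_A G = linear_ext AA (vs sM) UNIV (\<lambda>(x, y). over x y) (\<lambda>(x, y). lact x (G y))"

text \<open>Left B-linearity of \<open>G\<close> is the balancing condition for (x, y) \<mapsto> x
  G(y), so this map descends to A \<otimes>_B A.\<close>

lemma eval_A_Hom: "left_linear G \<Longrightarrow> eval_A G \<in> Hom AA (vs sM)"
  and eval_A_over: "left_linear G \<Longrightarrow> eval_A G (over x y) = lact x (G y)"
proof -
  assume G: "left_linear G"
  have l: "(\<lambda>x. lact x (G y)) \<in> Hom (vs sA) (vs sM)" for y
    by (simp add: Hom_vs_iff lact_add_left lact_scale_left)
  have r: "(\<lambda>y. lact x (G y)) \<in> Hom (vs sA) (vs sM)" for x
    using G by (simp add: left_linear_def Hom_vs_iff lact_add_right lact_scale_right)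
  have b: "lact (x * b) (G y) = lact x (G (b * y))" if "b \<in> B" for x b y
    using G that by (simp add: left_linear_def lact_mult)
  show "eval_A G \<in> Hom AA (vs sM)" "eval_A G (over x y) = lact x (G y)"
    using VM.over_lift[OF l r b] by (simp_all add: eval_A_def)
qed

lemmas eval_A_add = Hom_add[OF eval_A_Hom]
  and eval_A_scal = Hom_scal[OF eval_A_Hom]

lemma left_linear_add: "left_linear G \<Longrightarrow> left_linear G' \<Longrightarrow> left_linear (\<lambda>y. G y + G' y)"
  and left_linear_scale: "left_linear G \<Longrightarrow> left_linear (\<lambda>y. sM r (G y))"
  and left_linear_ract: "left_linear G \<Longrightarrow> left_linear (\<lambda>y. ract (G y) a)"
  and left_linear_mult: "left_linear G \<Longrightarrow> left_linear (\<lambda>y. G (y * a))"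
  and left_linear_zero: "left_linear (\<lambda>y. 0)"
  by (simp_all add: left_linear_def Hom_vs_iff lact_add_right lact_scale_right M.scale_right_distrib
      ract_add_left ract_scale_left lact_ract distrib_right scale_mult_left mult.assoc mult.commute[where ?'a = 'k])

lemma left_linear_sum:
  assumes "finite I" "\<And>i. i \<in> I \<Longrightarrow> left_linear (G i)"
  shows "left_linear (\<lambda>y. \<Sum>i\<in>I. G i y)"
  using assms by (induction I rule: finite_induct) (simp_all add: left_linear_zero left_linear_add)

lemma eval_A_fun:
  assumes "t \<in> carr AA" "left_linear G"
  shows eval_A_fun_add: "left_linear G' \<Longrightarrow> eval_A (\<lambda>y. G y + G' y) t = eval_A G t + eval_A G' t"
    and eval_A_fun_scale: "eval_A (\<lambda>y. sM r (G y)) t = sM r (eval_A G t)"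
    and eval_A_fun_ract: "eval_A (\<lambda>y. ract (G y) a) t = ract (eval_A G t) a"
    and eval_A_right_mult: "eval_A G (right_mult sA B t a) = eval_A (\<lambda>y. G (y * a)) t"
    and eval_A_left_over: "eval_A G (left_over a t) = lact a (eval_A G t)"
proof -
  show "eval_A (\<lambda>y. G y + G' y) t = eval_A G t + eval_A G' t" if "left_linear G'"
    using assms(1)
    by (induction rule: tensor_over_induct)
      (simp_all add: assms(2) that left_linear_add eval_A_over eval_A_add eval_A_scal lact_add_right
        M.scale_right_distrib)
  show "eval_A (\<lambda>y. sM r (G y)) t = sM r (eval_A G t)"
    using assms(1)
    by (induction rule: tensor_over_induct)
      (simp_all add: assms(2) left_linear_scale eval_A_over eval_A_add eval_A_scal lact_scale_right
        M.scale_right_distrib mult.commute)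
  show "eval_A (\<lambda>y. ract (G y) a) t = ract (eval_A G t) a"
    using assms(1)
    by (induction rule: tensor_over_induct)
      (simp_all add: assms(2) left_linear_ract eval_A_over eval_A_add eval_A_scal lact_ract ract_add_left
        ract_scale_left)
  show "eval_A G (right_mult sA B t a) = eval_A (\<lambda>y. G (y * a)) t"
    using assms(1)
    by (induction rule: tensor_over_induct)
      (simp_all add: assms(2) left_linear_mult eval_A_over eval_A_add eval_A_scal
        right_mult_add right_mult_scal)
  show "eval_A G (left_over a t) = lact a (eval_A G t)"
    using assms(1)
    by (induction rule: tensor_over_induct)
      (simp_all add: assms(2) eval_A_over eval_A_add eval_A_scal lact_mult lact_add_right
        lact_scale_right left_over_add left_over_scal)
qed

lemma eval_A_fun_zero:
  assumes "t \<in> carr AA"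
  shows "eval_A (\<lambda>c. 0) t = 0"
  using eval_A_fun_scale[OF assms left_linear_zero, of 0] by simp

lemma eval_A_fun_sum:
  assumes "t \<in> carr AA" "finite I" "\<And>i. i \<in> I \<Longrightarrow> left_linear (G i)"
  shows "eval_A (\<lambda>y. \<Sum>i\<in>I. G i y) t = (\<Sum>i\<in>I. eval_A (G i) t)"
  using assms(2,3)
  by (induction I rule: finite_induct)
    (simp_all add: assms(1) eval_A_fun_zero eval_A_fun_add left_linear_sum)

text \<open>The mutually inverse maps between \<open>Hom(C, M)\<close> and the left \<open>B\<close>-linear maps \<open>A \<rightarrow> M\<close>.\<close>

definition to_A :: "('c \<Rightarrow> 'm) \<Rightarrow> 'a \<Rightarrow> 'm" where
  "to_A \<phi> y = eval_C \<phi> (\<rho> y)"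

definition to_C :: "('a \<Rightarrow> 'm) \<Rightarrow> 'c \<Rightarrow> 'm" where
  "to_C G c = eval_A G (translation c)"

lemma left_linear_to_A: "\<phi> \<in> CM \<Longrightarrow> left_linear (to_A \<phi>)"
  by (simp add: left_linear_def Hom_vs_iff to_A_def coact_add coact_scale eval_C_add eval_C_scal
      coact_coinvariant eval_C_left_mult)

lemma to_C_CM: "left_linear G \<Longrightarrow> to_C G \<in> CM"
  by (simp add: Hom_vs_iff to_C_def translation_add translation_scale eval_A_add eval_A_scal)

text \<open>Both sides are left A-linear in \<open>t\<close>, and on \<open>over 1 y\<close> they
  agree because \<open>to_A\<close> is defined by evaluating at \<open>\<rho> y\<close>. With
  \<open>t = translation c\<close> this gives one half of the bijection.\<close>

lemma eval_C_can:
  assumes "\<phi> \<in> CM" "t \<in> carr AA"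
  shows "eval_C \<phi> (can sA sC \<rho> t) = eval_A (to_A \<phi>) t"
  using assms(2)
  by (induction rule: tensor_over_induct)
    (simp_all add: assms(1) left_linear_to_A eval_A_over eval_A_add eval_A_scal can_add can_scal
      eval_C_add eval_C_scal eval_C_left_mult to_A_def[symmetric])

lemma to_C_to_A: "\<phi> \<in> CM \<Longrightarrow> to_C (to_A \<phi>) = \<phi>"
  by (simp add: fun_eq_iff to_C_def eval_C_can[symmetric] eval_C_pure lact_one)

text \<open>Stated on A \<otimes> C because there \<open>can_inv_pure\<close> expresses pure tensors
  by the translation map, in terms of which \<open>to_C\<close> is defined. The version for A
  \<otimes>_B A follows by substituting \<open>can\<close>.\<close>

lemma eval_C_to_C_can_inv:
  assumes "left_linear G" "t \<in> carr AC"
  shows "eval_C (to_C G) t = eval_A G (can_inv t)"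
  using assms(2)
proof (induction rule: tensor_vs_induct)
  case (pure a c)
  then show ?case
    using assms(1) by (simp add: to_C_CM eval_C_pure can_inv_pure eval_A_left_over) (simp add: to_C_def)
qed (simp_all add: assms(1) to_C_CM eval_C_add eval_C_scal eval_A_add eval_A_scal can_inv_add can_inv_scal)

lemma eval_C_to_C_can: "left_linear G \<Longrightarrow> t \<in> carr AA \<Longrightarrow> eval_C (to_C G) (can sA sC \<rho> t) = eval_A G t"
  by (simp add: eval_C_to_C_can_inv)

text \<open>\<open>can\<close> sends \<open>over 1 y\<close> to \<open>\<rho> y\<close>, so
  evaluating there recovers \<open>G y\<close>.\<close>

lemma to_A_to_C: "left_linear G \<Longrightarrow> to_A (to_C G) = G"
  using eval_C_to_C_can[of G "over 1 y" for y]
  by (simp add: fun_eq_iff to_A_def eval_A_over lact_one left_mult_one)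

text \<open>The entwining is \<open>can\<close> applied to \<open>translation c\<close> multiplied
  by \<open>a\<close> on the right. Evaluation turns \<open>can\<close> into
  \<open>eval_A (to_A \<phi>)\<close>, and the factor \<open>a\<close> lands on the second leg of
  the translation map.\<close>

lemma eval_C_entwining:
  assumes "\<phi> \<in> CM"
  shows "(\<lambda>c. eval_C \<phi> (\<psi> (pure_tensor (vs sC) (vs sA) c a))) = to_C (\<lambda>y. to_A \<phi> (y * a))"
  using assms
  by (simp add: fun_eq_iff canonical_entwining_pure eval_C_can eval_A_right_mult left_linear_to_A to_C_def)

lemma to_C_add: "left_linear G \<Longrightarrow> left_linear G' \<Longrightarrow> to_C (\<lambda>y. G y + G' y) c = to_C G c + to_C G' c"
  and to_C_scale: "left_linear G \<Longrightarrow> to_C (\<lambda>y. sM r (G y)) c = sM r (to_C G c)"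
  and to_C_ract: "left_linear G \<Longrightarrow> to_C (\<lambda>y. ract (G y) a) c = ract (to_C G c) a"
  by (simp_all add: to_C_def eval_A_fun_add eval_A_fun_scale eval_A_fun_ract)

lemma to_C_sum:
  "finite I \<Longrightarrow> (\<And>i. i \<in> I \<Longrightarrow> left_linear (G i)) \<Longrightarrow> to_C (\<lambda>y. \<Sum>i\<in>I. G i y) c = (\<Sum>i\<in>I. to_C (G i) c)"
  by (simp add: to_C_def eval_A_fun_sum)

lemma to_A_add: "\<phi> \<in> CM \<Longrightarrow> \<phi>' \<in> CM \<Longrightarrow> to_A (\<lambda>c. \<phi> c + \<phi>' c) y = to_A \<phi> y + to_A \<phi>' y"
  and to_A_scale: "\<phi> \<in> CM \<Longrightarrow> to_A (\<lambda>c. sM r (\<phi> c)) y = sM r (to_A \<phi> y)"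
  and to_A_ract: "\<phi> \<in> CM \<Longrightarrow> to_A (\<lambda>c. ract (\<phi> c) a) y = ract (to_A \<phi> y) a"
  and to_A_zero: "to_A (\<lambda>c. 0) y = 0"
  by (simp_all add: to_A_def eval_C_fun_add eval_C_fun_scale eval_C_fun_ract eval_C_fun_zero)

lemma to_A_sum:
  "finite I \<Longrightarrow> (\<And>i. i \<in> I \<Longrightarrow> \<phi> i \<in> CM) \<Longrightarrow> to_A (\<lambda>c. \<Sum>i\<in>I. \<phi> i c) y = (\<Sum>i\<in>I. to_A (\<phi> i) y)"
  by (simp add: to_A_def eval_C_fun_sum)

end

section \<open>The cochain complex\<close>

context galois_bimodule
begin

abbreviation "chain \<equiv> chain_elem sA sC"
abbreviation "cochain n \<equiv> Hom (vs sC \<otimes> tensor_power (vs sA) n) (vs sM)"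
abbreviation "\<delta> \<equiv> coboundary sA sC \<psi> sM lact ract"

definition coboundary_value :: "nat \<Rightarrow> (('c \<times> ('a list \<Rightarrow>\<^sub>0 'k) set \<Rightarrow>\<^sub>0 'k) set \<Rightarrow> 'm) \<Rightarrow> 'c \<Rightarrow> 'a list \<Rightarrow> 'm"
  where
  "coboundary_value n f c as =
     eval_C (\<lambda>c'. f (chain c' (tl as))) (\<psi> (pure_tensor (vs sC) (vs sA) c (hd as)))
     + (\<Sum>i = 1..n. sM ((-1) ^ i) (f (chain c (contract i as))))
     + sM ((-1) ^ (n + 1)) (ract (f (chain c (butlast as))) (last as))"

lemma chain_CM: "f \<in> cochain n \<Longrightarrow> length as = n \<Longrightarrow> (\<lambda>c. f (chain c as)) \<in> CM"
  by (rule linear_chain_elem)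

lemma chain_contract_CM:
  assumes "f \<in> cochain n" "length as = Suc n" "i \<in> {1..n}"
  shows "(\<lambda>c. f (chain c (contract i as))) \<in> CM"
  using assms by (intro chain_CM) (auto simp: length_contract)

lemma multilinear_eval_C:
  assumes f: "f \<in> cochain n" and t: "t \<in> carr AC"
  shows "multilinear sA sM n (\<lambda>as. eval_C (\<lambda>c. f (chain c as)) t)"
  unfolding multilinear_def
proof (intro allI impI)
  fix xs ys :: "'a list" assume len: "Suc (length xs + length ys) = n"
  have "(\<lambda>v. f (chain c (xs @ v # ys))) \<in> Hom (vs sA) (vs sM)" for c
    using multilinear_chain_elem[OF f] len by (simp add: multilinear_def)
  moreover have "(\<lambda>c. f (chain c (xs @ v # ys))) \<in> CM" for v
    using len by (intro chain_CM[OF f]) simp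
  ultimately show "(\<lambda>v. eval_C (\<lambda>c. f (chain c (xs @ v # ys))) t) \<in> Hom (vs sA) (vs sM)"
    by (simp add: Hom_vs_iff eval_C_fun_add[OF t] eval_C_fun_scale[OF t])
qed

text \<open>Justifies the definite description behind \<open>\<delta>\<close>: each term is linear
  in \<open>c\<close> and multilinear in the list. For the entwined term, linearity in
  \<open>c\<close> comes from \<open>eval_C_entwining\<close>.\<close>

lemma coboundary_Hom: "f \<in> cochain n \<Longrightarrow> \<delta> n f \<in> cochain (Suc n)"
  and coboundary_chain:
    "f \<in> cochain n \<Longrightarrow> length as = Suc n \<Longrightarrow> \<delta> n f (chain c as) = coboundary_value n f c as"
proof -
  assume f: "f \<in> cochain n"
  have lin: "(\<lambda>c. coboundary_value n f c as) \<in> CM" if as: "length as = Suc n" for as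
  proof -
    have "(\<lambda>c. f (chain c (tl as))) \<in> CM" "(\<lambda>c. f (chain c (butlast as))) \<in> CM"
      using as by (auto intro: chain_CM[OF f])
    then show ?thesis
      unfolding coboundary_value_def
      by (intro CM_add CM_sum CM_scale CM_ract chain_contract_CM[OF f as])
        (simp_all add: eval_C_entwining to_C_CM left_linear_mult left_linear_to_A)
  qed
  have "multilinear sA sM (Suc n)
      (\<lambda>as. eval_C (\<lambda>c'. f (chain c' (tl as))) (\<psi> (pure_tensor (vs sC) (vs sA) c (hd as))))" for c
  proof -
    have "(\<lambda>v. eval_C (\<lambda>c'. f (chain c' ys)) (\<psi> (pure_tensor (vs sC) (vs sA) c v))) \<in> Hom (vs sA) (vs sM)"
      if "length ys = n" for ys
      using entwining_linear_right[of c] eval_C_add[OF chain_CM[OF f that]] eval_C_scal[OF chain_CM[OF f that]]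
      by (simp add: Hom_vs_iff)
    then show ?thesis using f by (simp add: multilinear_Suc multilinear_eval_C)
  qed
  moreover have "multilinear sA sM (Suc n) (\<lambda>as. f (chain c (contract i as)))" if "i \<in> {1..n}" for i c
    using that by (intro multilinear_contract multilinear_chain_elem[OF f]) (unfold_locales, auto)
  moreover have "multilinear sA sM (Suc n) (\<lambda>as. ract (f (chain c (butlast as))) (last as))" for c
    by (intro multilinear_ract_last[OF _ multilinear_chain_elem[OF f]]) unfold_locales
  ultimately have multi: "multilinear sA sM (Suc n) (coboundary_value n f c)" for c
    unfolding coboundary_value_def[abs_def]
    by (intro multilinear_add[OF M.vector_space_axioms] multilinear_sum[OF M.vector_space_axioms]
        multilinear_scale[OF M.vector_space_axioms])
  have eq: "\<delta> n f = linear_ext (vs sC \<otimes> tensor_power (vs sA) (Suc n)) (vs sM) (UNIV \<times> words UNIV (Suc n))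
      (\<lambda>(c, as). chain c as) (\<lambda>(c, as). coboundary_value n f c as)"
    by (simp add: coboundary_def coboundary_value_def eval_C_def)
  show "\<delta> n f \<in> cochain (Suc n)"
    unfolding eq by (rule chain_lift(1)[OF M.vector_space_axioms lin multi])
  show "\<delta> n f (chain c as) = coboundary_value n f c as" if "length as = Suc n"
    unfolding eq by (rule chain_lift(2)[OF M.vector_space_axioms lin multi that])
qed

lemma cochain_add: "f \<in> cochain n \<Longrightarrow> g \<in> cochain n \<Longrightarrow> f + g \<in> cochain n"
  and cochain_scale: "f \<in> cochain n \<Longrightarrow> (\<lambda>t. sM r (f t)) \<in> cochain n"
  and cochain_zero: "0 \<in> cochain n"
  by (auto simp: Hom_def M.scale_right_distrib add_ac mult.commute)

lemma coboundary_add: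
  assumes f: "f \<in> cochain n" and g: "g \<in> cochain n"
  shows "\<delta> n (f + g) = \<delta> n f + \<delta> n g"
proof (rule Hom_chain_eqI[where sM = sM])
  fix c and as :: "'a list" assume as: "length as = Suc n"
  have "(\<lambda>c. f (chain c (tl as))) \<in> CM" "(\<lambda>c. g (chain c (tl as))) \<in> CM"
    using as f g by (auto intro: chain_CM)
  then show "\<delta> n (f + g) (chain c as) = (\<delta> n f + \<delta> n g) (chain c as)"
    using as f g
    by (simp add: coboundary_chain cochain_add coboundary_value_def eval_C_fun_add sum.distrib
        M.scale_right_distrib ract_add_left)
qed (use f g in \<open>simp_all add: cochain_add coboundary_Hom\<close>)

lemma coboundary_scale:
  assumes f: "f \<in> cochain n"
  shows "\<delta> n (\<lambda>t. sM r (f t)) = (\<lambda>t. sM r (\<delta> n f t))"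
proof (rule Hom_chain_eqI[where sM = sM])
  fix c and as :: "'a list" assume as: "length as = Suc n"
  have "(\<lambda>c. f (chain c (tl as))) \<in> CM"
    using as f by (auto intro: chain_CM)
  then show "\<delta> n (\<lambda>t. sM r (f t)) (chain c as) = sM r (\<delta> n f (chain c as))"
    using as f
    by (simp add: coboundary_chain cochain_scale coboundary_value_def eval_C_fun_scale
        M.scale_sum_right M.scale_right_distrib M.scale_right_diff_distrib ract_scale_left mult.commute)
qed (use f in \<open>simp_all add: cochain_scale coboundary_Hom\<close>)

lemma coboundary_zero: "\<delta> n 0 = 0"
  using coboundary_scale[OF cochain_zero, of n 0] by (simp add: fun_eq_iff zero_fun_def)

lemma cocycles_eq: "cocycles sA sC \<psi> sM lact ract n = {f \<in> cochain n. \<delta> n f = 0}"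
  by (simp add: cocycles_def cochains_def)

section \<open>Degree zero\<close>

text \<open>Since \<open>to_C\<close> is injective on left B-linear maps, vanishing of \<delta> f
  for all c says that G(ya) = G(y)a for all y and a. Taking y = 1 gives the stated form; the
  converse is associativity of the right action.\<close>

lemma cocycle_0_iff:
  assumes f: "f \<in> cochain 0"
  defines "G \<equiv> to_A (\<lambda>c. f (chain c []))"
  shows "\<delta> 0 f = 0 \<longleftrightarrow> (\<forall>y. G y = ract (G 1) y)"
proof -
  let ?\<phi> = "\<lambda>c. f (chain c [])"
  have \<phi>: "?\<phi> \<in> CM" by (simp add: chain_CM[OF f])
  have G: "left_linear G" by (simp add: G_def left_linear_to_A \<phi>)
  have "\<delta> 0 f = 0 \<longleftrightarrow> (\<forall>c as. length as = Suc 0 \<longrightarrow> \<delta> 0 f (chain c as) = 0)"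
    using Hom_chain_eqI[OF coboundary_Hom[OF f] cochain_zero] by auto
  also have "\<dots> \<longleftrightarrow> (\<forall>c a. \<delta> 0 f (chain c [a]) = 0)"
    by (auto simp: length_Suc_conv)
  also have "\<dots> \<longleftrightarrow> (\<forall>a. to_C (\<lambda>y. G (y * a)) = to_C (\<lambda>y. ract (G y) a))"
  proof -
    have "\<delta> 0 f (chain c [a]) = to_C (\<lambda>y. G (y * a)) c - to_C (\<lambda>y. ract (G y) a) c" for c a
    proof -
      have "\<delta> 0 f (chain c [a]) = to_C (\<lambda>y. G (y * a)) c - ract (?\<phi> c) a"
        using fun_cong[OF eval_C_entwining[OF \<phi>, of a], of c]
        by (simp add: coboundary_chain[OF f] coboundary_value_def G_def)
      then show ?thesis
        using to_C_to_A[OF \<phi>] by (simp add: to_C_ract[OF G]) (simp add: G_def)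
    qed
    then show ?thesis by (auto simp: fun_eq_iff)
  qed
  also have "\<dots> \<longleftrightarrow> (\<forall>a. (\<lambda>y. G (y * a)) = (\<lambda>y. ract (G y) a))"
    using to_A_to_C[OF left_linear_mult[OF G]] to_A_to_C[OF left_linear_ract[OF G]] by metis
  also have "\<dots> \<longleftrightarrow> (\<forall>y. G y = ract (G 1) y)"
  proof
    assume G1: "\<forall>a. (\<lambda>y. G (y * a)) = (\<lambda>y. ract (G y) a)"
    show "\<forall>y. G y = ract (G 1) y"
      by (rule allI) (rule fun_cong[OF G1[rule_format], of 1, unfolded mult_1_left])
  next
    assume G1: "\<forall>y. G y = ract (G 1) y"
    have "G (y * a) = ract (G y) a" for y a
      using G1[rule_format, of "y * a"] G1[rule_format, of y] by (simp add: ract_mult)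
    then show "\<forall>a. (\<lambda>y. G (y * a)) = (\<lambda>y. ract (G y) a)" by blast
  qed
  finally show ?thesis .
qed

definition value_at_1 :: "(('c \<times> ('a list \<Rightarrow>\<^sub>0 'k) set \<Rightarrow>\<^sub>0 'k) set \<Rightarrow> 'm) \<Rightarrow> 'm" where
  "value_at_1 f = to_A (\<lambda>c. f (chain c [])) 1"

text \<open>For m = G(1), the element G(b1) equals bm by left B-linearity and mb by the cocycle
  condition. Conversely, bm = mb is what makes y \<mapsto> my left B-linear.\<close>

lemma value_at_1_bij:
  "bij_betw value_at_1 (cocycles sA sC \<psi> sM lact ract 0) {m. \<forall>b\<in>B. lact b m = ract m b}"
  unfolding bij_betw_def
proof
  show "inj_on value_at_1 (cocycles sA sC \<psi> sM lact ract 0)"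
  proof (rule inj_onI)
    fix f g assume "f \<in> cocycles sA sC \<psi> sM lact ract 0" "g \<in> cocycles sA sC \<psi> sM lact ract 0"
      and eq: "value_at_1 f = value_at_1 g"
    then have fg: "f \<in> cochain 0" "\<delta> 0 f = 0" "g \<in> cochain 0" "\<delta> 0 g = 0"
      by (auto simp: cocycles_eq)
    have "to_A (\<lambda>c. f (chain c [])) y = to_A (\<lambda>c. g (chain c [])) y" for y
      using cocycle_0_iff[OF fg(1)] cocycle_0_iff[OF fg(3)] fg(2,4) eq unfolding value_at_1_def by metis
    then have eqA: "to_A (\<lambda>c. f (chain c [])) = to_A (\<lambda>c. g (chain c []))" by (rule ext)
    have "(\<lambda>c. f (chain c [])) = (\<lambda>c. g (chain c []))"
      using arg_cong[OF eqA, of to_C] 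
      by (simp only: to_C_to_A[OF chain_CM[OF fg(1) list.size(3)]] to_C_to_A[OF chain_CM[OF fg(3) list.size(3)]])
    then show "f = g" by (intro Hom_chain_eqI[OF fg(1,3)]) (auto dest: fun_cong)
  qed
  show "value_at_1 ` cocycles sA sC \<psi> sM lact ract 0 = {m. \<forall>b\<in>B. lact b m = ract m b}"
  proof (intro equalityI subsetI)
    fix m assume "m \<in> value_at_1 ` cocycles sA sC \<psi> sM lact ract 0"
    then obtain f where f: "f \<in> cochain 0" "\<delta> 0 f = 0" and m: "m = value_at_1 f"
      by (auto simp: cocycles_eq)
    have "lact b m = ract m b" if "b \<in> B" for b
    proof -
      have "left_linear (to_A (\<lambda>c. f (chain c [])))"
        by (simp add: left_linear_to_A chain_CM[OF f(1)])
      then have "lact b m = to_A (\<lambda>c. f (chain c [])) (b * 1)"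
        using that by (simp only: left_linear_def m value_at_1_def)
      also have "\<dots> = ract m b"
        using cocycle_0_iff[OF f(1)] f(2) unfolding m value_at_1_def mult_1_right by blast
      finally show ?thesis .
    qed
    then show "m \<in> {m. \<forall>b\<in>B. lact b m = ract m b}" by simp
  next
    fix m assume m: "m \<in> {m. \<forall>b\<in>B. lact b m = ract m b}"
    define G where "G = ract m"
    have G: "left_linear G"
      using m by (auto simp: G_def left_linear_def Hom_vs_iff ract_add_right ract_scale_right
          ract_mult lact_ract[symmetric])
    define f where "f = linear_ext (vs sC \<otimes> tensor_power (vs sA) 0) (vs sM) (UNIV \<times> words UNIV 0)
       (\<lambda>(c, as). chain c as) (\<lambda>(c, as). to_C G c)"
    have f: "f \<in> cochain 0" "f (chain c []) = to_C G c" for c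
      unfolding f_def using chain_lift[OF M.vector_space_axioms, where n = 0 and g = "\<lambda>c as. to_C G c"
          and sC = sC and sA = sA] to_C_CM[OF G] by simp_all
    have "to_A (\<lambda>c. f (chain c [])) = G"
      by (simp add: f(2) to_A_to_C[OF G])
    then have "value_at_1 f = m" "\<delta> 0 f = 0"
      using cocycle_0_iff[OF f(1)] by (simp_all add: value_at_1_def G_def ract_one)
    then show "m \<in> value_at_1 ` cocycles sA sC \<psi> sM lact ract 0"
      using f(1) by (force simp: cocycles_eq)
  qed
qed

lemma value_at_1_add: "f \<in> cochain 0 \<Longrightarrow> g \<in> cochain 0 \<Longrightarrow> value_at_1 (f + g) = value_at_1 f + value_at_1 g"
  and value_at_1_scale: "f \<in> cochain 0 \<Longrightarrow> value_at_1 (\<lambda>t. sM r (f t)) = sM r (value_at_1 f)"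
  by (simp_all add: value_at_1_def to_A_add to_A_scale chain_CM)

text \<open>The coboundaries in degree 0 form \<open>{0}\<close>, so every coset is a singleton and
  \<open>the_elem\<close> returns its cocycle.\<close>

lemma cohomology_0:
  "kspace_iso (cohomology sA sC \<psi> sM lact ract 0)
     \<lparr>carr = {m. \<forall>b\<in>B. lact b m = ract m b}, scal = sM\<rparr>"
proof -
  let ?Z = "cocycles sA sC \<psi> sM lact ract 0" and ?W = "{m. \<forall>b\<in>B. lact b m = ract m b}"
  let ?H = "cohomology sA sC \<psi> sM lact ract 0"
  have sing: "f +o {0} = {f}" "{f} + {g} = {f + g}" for f g :: "('c \<times> ('a list \<Rightarrow>\<^sub>0 'k) set \<Rightarrow>\<^sub>0 'k) set \<Rightarrow> 'm"
    by (auto simp: elt_set_plus_def set_plus_def)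
  have carr: "carr ?H = (\<lambda>f. {f}) ` ?Z"
    by (simp add: cohomology_def coboundaries_def quotient_space_def sing)
  have scal: "scal ?H r {f} = {\<lambda>t. sM r (f t)}" for r f
    by (simp add: cohomology_def coboundaries_def quotient_space_def sing cochains_def)
  define h where "h X = (if X \<in> carr ?H then value_at_1 (the_elem X) else 0)" for X
  have h: "h {f} = value_at_1 f" if "f \<in> ?Z" for f
    using that by (simp add: h_def carr)
  have Z: "f + g \<in> ?Z" "(\<lambda>t. sM r (f t)) \<in> ?Z" if "f \<in> ?Z" "g \<in> ?Z" for f g r
    using that by (auto simp: cocycles_eq cochain_add cochain_scale coboundary_add coboundary_scale zero_fun_def)
  have "h \<in> Hom ?H \<lparr>carr = ?W, scal = sM\<rparr>"
  proof (rule HomI)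
    show "h X \<in> carr \<lparr>carr = ?W, scal = sM\<rparr>" if "X \<in> carr ?H" for X
      using that h bij_betw_apply[OF value_at_1_bij] by (auto simp: carr)
    show "h (X + Y) = h X + h Y" if "X \<in> carr ?H" "Y \<in> carr ?H" for X Y
      using that Z by (auto simp: carr sing h) (auto simp: value_at_1_add cocycles_eq)
    show "h (scal ?H r X) = scal \<lparr>carr = ?W, scal = sM\<rparr> r (h X)" if "X \<in> carr ?H" for X r
      using that Z by (auto simp: carr scal h) (auto simp: value_at_1_scale cocycles_eq)
  qed (simp add: h_def)
  moreover have "bij_betw h (carr ?H) ?W"
  proof -
    have "bij_betw (h \<circ> (\<lambda>f. {f})) ?Z ?W"
      using value_at_1_bij by (simp add: bij_betw_cong[of ?Z "h \<circ> (\<lambda>f. {f})" value_at_1] h)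
    moreover have "bij_betw (\<lambda>f. {f}) ?Z (carr ?H)"
      by (auto simp: carr bij_betw_def inj_on_def)
    ultimately show ?thesis using bij_betw_comp_iff by blast
  qed
  ultimately show ?thesis unfolding kspace_iso_def by auto
qed

section \<open>Galois objects\<close>

definition cochain_A :: "(('c \<times> ('a list \<Rightarrow>\<^sub>0 'k) set \<Rightarrow>\<^sub>0 'k) set \<Rightarrow> 'm) \<Rightarrow> 'a \<Rightarrow> 'a list \<Rightarrow> 'm" where
  "cochain_A f y as = to_A (\<lambda>c. f (chain c as)) y"

text \<open>This is the cocycle identity for the list \<open>y # as\<close>, carried over by
  \<open>to_A\<close> and evaluated at 1. Its entwined term is
  \<open>cochain_A f (1 * y) as\<close>; the other terms, moved across, form the differential of a
  cochain of one degree less that has 1 in front and \<open>y\<close> in the first list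
  place.\<close>

lemma cochain_A_cocycle:
  assumes f: "f \<in> cochain (Suc n)" "\<delta> (Suc n) f = 0" and as: "length as = Suc n"
  shows "cochain_A f y as =
    cochain_A f 1 ((y * hd as) # tl as)
    + (\<Sum>i = 1..n. sM ((-1) ^ i) (cochain_A f 1 (y # contract i as)))
    + sM ((-1) ^ (n + 1)) (ract (cochain_A f 1 (y # butlast as)) (last as))"
proof -
  obtain a bs where ab: "as = a # bs" "length bs = n" using as by (cases as) auto
  let ?\<phi> = "\<lambda>c. f (chain c as)"
  have \<phi>: "?\<phi> \<in> CM" by (rule chain_CM[OF f(1) as])
  have contr: "(\<lambda>c. f (chain c (contract i (y # as)))) \<in> CM" if "i \<in> {1..Suc n}" for i
    using that as by (intro chain_contract_CM[OF f(1)]) auto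
  have last: "(\<lambda>c. f (chain c (butlast (y # as)))) \<in> CM"
    using as by (intro chain_CM[OF f(1)]) auto
  let ?E = "\<lambda>c. eval_C ?\<phi> (\<psi> (pure_tensor (vs sC) (vs sA) c y))"
  have E: "?E = to_C (\<lambda>x. to_A ?\<phi> (x * y))" by (rule eval_C_entwining[OF \<phi>])
  have El: "left_linear (\<lambda>x. to_A ?\<phi> (x * y))" by (intro left_linear_mult left_linear_to_A \<phi>)
  have "(\<lambda>c. coboundary_value (Suc n) f c (y # as)) = (\<lambda>c. 0)"
    using coboundary_chain[OF f(1), of "y # as"] as by (simp add: f(2) fun_eq_iff)
  then have "to_A (\<lambda>c. coboundary_value (Suc n) f c (y # as)) 1 = 0"
    by (simp add: to_A_zero)
  moreover have "to_A (\<lambda>c. coboundary_value (Suc n) f c (y # as)) 1 =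
     to_A ?E 1 + (\<Sum>i = 1..Suc n. sM ((-1) ^ i) (cochain_A f 1 (contract i (y # as))))
     + sM ((-1) ^ (Suc n + 1)) (ract (cochain_A f 1 (butlast (y # as))) (last (y # as)))"
  proof -
    have EC: "?E \<in> CM" unfolding E by (rule to_C_CM[OF El])
    have SC: "(\<lambda>c. \<Sum>i = 1..Suc n. sM ((-1) ^ i) (f (chain c (contract i (y # as))))) \<in> CM"
      by (intro CM_sum CM_scale contr)
    have LC: "(\<lambda>c. sM ((-1) ^ (Suc n + 1)) (ract (f (chain c (butlast (y # as)))) (last (y # as)))) \<in> CM"
      by (intro CM_scale CM_ract last)
    have "to_A (\<lambda>c. \<Sum>i = 1..Suc n. sM ((-1) ^ i) (f (chain c (contract i (y # as))))) 1 =
       (\<Sum>i = 1..Suc n. sM ((-1) ^ i) (cochain_A f 1 (contract i (y # as))))"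
      using contr by (subst to_A_sum) (auto simp: CM_scale to_A_scale cochain_A_def intro!: sum.cong)
    moreover have "to_A (\<lambda>c. sM ((-1) ^ (Suc n + 1)) (ract (f (chain c (butlast (y # as)))) (last (y # as)))) 1 =
       sM ((-1) ^ (Suc n + 1)) (ract (cochain_A f 1 (butlast (y # as))) (last (y # as)))"
      by (simp only: to_A_scale to_A_ract CM_ract last cochain_A_def)
    ultimately show ?thesis
      by (simp only: coboundary_value_def list.sel to_A_add EC SC LC CM_add)
  qed
  moreover have "to_A ?E 1 = cochain_A f y as"
    by (simp add: E to_A_to_C[OF El] cochain_A_def)
  \<comment> \<open>The summand for \<open>i = 1\<close> merges \<open>y\<close> with the head of
    \<open>as\<close>. The others contract inside \<open>as\<close> with index lowered by one, which
    reverses their sign.\<close>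
  moreover have "(\<Sum>i = 1..Suc n. sM ((-1) ^ i) (cochain_A f 1 (contract i (y # as)))) =
      - cochain_A f 1 ((y * hd as) # tl as)
      - (\<Sum>i = 1..n. sM ((-1) ^ i) (cochain_A f 1 (y # contract i as)))"
  proof -
    have "(\<Sum>i = 1..Suc n. sM ((-1) ^ i) (cochain_A f 1 (contract i (y # as)))) =
        sM (-1) (cochain_A f 1 (contract 1 (y # as))) +
        (\<Sum>i = 1..n. sM ((-1) ^ Suc i) (cochain_A f 1 (contract (Suc i) (y # as))))"
      using sum.atLeast_Suc_atMost[of 1 "Suc n" "\<lambda>i. sM ((-1) ^ i) (cochain_A f 1 (contract i (y # as)))"]
        sum.shift_bounds_cl_Suc_ivl[of "\<lambda>i. sM ((-1) ^ i) (cochain_A f 1 (contract i (y # as)))" 1 n]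
      by simp
    also have "(\<Sum>i = 1..n. sM ((-1) ^ Suc i) (cochain_A f 1 (contract (Suc i) (y # as)))) =
        - (\<Sum>i = 1..n. sM ((-1) ^ i) (cochain_A f 1 (y # contract i as)))"
      by (simp add: contract_Suc sum_negf[symmetric])
    finally show ?thesis by (simp add: ab contract_1)
  qed
  moreover have "butlast (y # as) = y # butlast as" "last (y # as) = last as"
    using as by auto
  moreover have "sM ((-1) ^ (Suc n + 1)) x = - sM ((-1) ^ (n + 1)) x" for x
    by simp
  ultimately have "cochain_A f y as + (- cochain_A f 1 ((y * hd as) # tl as)
      - (\<Sum>i = 1..n. sM ((-1) ^ i) (cochain_A f 1 (y # contract i as))))
      + - sM ((-1) ^ (n + 1)) (ract (cochain_A f 1 (y # butlast as)) (last as)) = 0"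
    by (simp only:)
  moreover have "p = q + r + u" if "p + (- q - r) + - u = 0" for p q r u :: 'm
  proof -
    have "p - (q + r + u) = 0" using that by (simp add: algebra_simps)
    then show ?thesis by simp
  qed
  ultimately show ?thesis by blast
qed

text \<open>The contracting homotopy inserts the unit of \<open>A\<close> into the left \<open>B\<close>-linear cochain
  \<open>cochain_A f\<close>; the result is again left \<open>B\<close>-linear because \<open>B\<close> consists of scalars.\<close>

lemma galois_object_exact:
  assumes B: "B = range (\<lambda>r. sA r 1)" and f: "f \<in> cochain (Suc n)" "\<delta> (Suc n) f = 0"
  shows "f \<in> \<delta> n ` cochain n"
proof -
  define G where "G as y = cochain_A f 1 (y # as)" for as y
  have multi: "multilinear sA sM (Suc n) (cochain_A f 1)"
    unfolding cochain_A_def[abs_def] to_A_def by (rule multilinear_eval_C[OF f(1) coact_carr])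
  have G: "left_linear (G as)" if "length as = n" for as
  proof -
    have lin: "G as \<in> Hom (vs sA) (vs sM)"
      using multi that by (simp add: multilinear_Suc G_def[abs_def])
    then show ?thesis
      using lact_scale_left by (auto simp: left_linear_def B Hom_vs_iff scale_mult_left lact_one)
  qed
  have "multilinear sA sM n (\<lambda>as. to_C (G as) c)" for c
    unfolding multilinear_def
  proof (intro allI impI)
    fix xs ys :: "'a list" assume len: "Suc (length xs + length ys) = n"
    have "(\<lambda>v. G (xs @ v # ys) y) \<in> Hom (vs sA) (vs sM)" for y
      using multi[unfolded multilinear_def, rule_format, of "y # xs" ys] len by (simp add: G_def)
    then have "G (xs @ (u + v) # ys) = (\<lambda>y. G (xs @ u # ys) y + G (xs @ v # ys) y)"
      "G (xs @ sA r u # ys) = (\<lambda>y. sM r (G (xs @ u # ys) y))" for u v r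
      by (simp_all add: Hom_vs_iff fun_eq_iff)
    then show "(\<lambda>v. to_C (G (xs @ v # ys)) c) \<in> Hom (vs sA) (vs sM)"
      using G len by (simp add: Hom_vs_iff to_C_add to_C_scale)
  qed
  then obtain g where g: "g \<in> cochain n" "\<And>c as. length as = n \<Longrightarrow> g (chain c as) = to_C (G as) c"
    using chain_lift[OF M.vector_space_axioms, where n = n and g = "\<lambda>c as. to_C (G as) c"] to_C_CM[OF G]
    by blast
  have "\<delta> n g = f"
  proof (rule Hom_chain_eqI[OF coboundary_Hom[OF g(1)] f(1)])
    fix c and as :: "'a list" assume as: "length as = Suc n"
    have len: "length (tl as) = n" "length (butlast as) = n"
      and lenc: "i \<in> {1..n} \<Longrightarrow> length (contract i as) = n" for i
      using as by (auto simp: length_contract)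
    have gA: "(\<lambda>c. g (chain c (tl as))) = to_C (G (tl as))"
      using g(2)[OF len(1)] by auto
    have "\<delta> n g (chain c as) = to_C (\<lambda>y. G (tl as) (y * hd as)) c
        + (\<Sum>i = 1..n. sM ((-1) ^ i) (to_C (G (contract i as)) c))
        + sM ((-1) ^ (n + 1)) (ract (to_C (G (butlast as)) c) (last as))"
      using fun_cong[OF eval_C_entwining[OF to_C_CM[OF G[OF len(1)]]]]
      by (simp add: coboundary_chain[OF g(1) as] coboundary_value_def gA g(2) as len(1) lenc
          to_A_to_C[OF G[OF len(1)]])
    \<comment> \<open>Collecting all terms under one \<open>to_C\<close> exposes as its argument the
      right-hand side of \<open>cochain_A_cocycle\<close>.\<close>
    also have "\<dots> = to_C (\<lambda>y. G (tl as) (y * hd as)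
        + (\<Sum>i = 1..n. sM ((-1) ^ i) (G (contract i as) y))
        + sM ((-1) ^ (n + 1)) (ract (G (butlast as) y) (last as))) c"
    proof -
      have l1: "left_linear (\<lambda>y. G (tl as) (y * hd as))"
        by (intro left_linear_mult G len)
      have l2: "left_linear (\<lambda>y. sM ((-1) ^ i) (G (contract i as) y))" if "i \<in> {1..n}" for i
        by (intro left_linear_scale G lenc that)
      have l2s: "left_linear (\<lambda>y. \<Sum>i = 1..n. sM ((-1) ^ i) (G (contract i as) y))"
        by (intro left_linear_sum l2) simp
      have l3: "left_linear (\<lambda>y. ract (G (butlast as) y) (last as))"
        by (intro left_linear_ract G len)
      have "(\<Sum>i = 1..n. sM ((-1) ^ i) (to_C (G (contract i as)) c)) =
          to_C (\<lambda>y. \<Sum>i = 1..n. sM ((-1) ^ i) (G (contract i as) y)) c"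
        using l2 by (subst to_C_sum) (auto intro!: sum.cong simp: to_C_scale G lenc)
      then show ?thesis
        by (simp only: to_C_add to_C_scale to_C_ract left_linear_add left_linear_scale l1 l2s l3 G len)
    qed
    also have "\<dots> = to_C (\<lambda>y. cochain_A f y as) c"
      by (simp only: cochain_A_cocycle[OF f as] G_def)
    also have "\<dots> = f (chain c as)"
      using to_C_to_A[OF chain_CM[OF f(1) as]] by (simp add: cochain_A_def fun_eq_iff)
    finally show "\<delta> n g (chain c as) = f (chain c as)" .
  qed
  then show ?thesis using g(1) by blast
qed

text \<open>The image of \<open>\<delta> n\<close> absorbs its own elements, being closed under sums
  and differences. It is not given as a \<open>free_span\<close>, so \<open>coset_eq_iff\<close>
  cannot be quoted.\<close>

lemma coset_coboundary:
  assumes "f \<in> \<delta> n ` cochain n"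
  shows "f +o \<delta> n ` cochain n = \<delta> n ` cochain n"
proof -
  obtain g where g: "g \<in> cochain n" "f = \<delta> n g" using assms by blast
  show ?thesis
  proof (intro equalityI subsetI)
    fix x assume "x \<in> f +o \<delta> n ` cochain n"
    then obtain h where "h \<in> cochain n" "x = \<delta> n (g + h)"
      using g by (auto simp: elt_set_plus_def coboundary_add)
    then show "x \<in> \<delta> n ` cochain n" using g(1) cochain_add by blast
  next
    fix x assume "x \<in> \<delta> n ` cochain n"
    then obtain h where h: "h \<in> cochain n" "x = \<delta> n h" by blast
    \<comment> \<open>Solving x = f + \<delta> h' suggests h' = h - g; the difference is written
      with the scalar -1 so that the closure lemmas for scaling apply.\<close>
    let ?h = "h + (\<lambda>t. sM (- 1) (g t))"
    have "?h \<in> cochain n" by (intro cochain_add cochain_scale h g)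
    moreover have "\<delta> n ?h = \<delta> n h + (\<lambda>t. sM (- 1) (\<delta> n g t))"
      by (simp only: coboundary_add cochain_scale coboundary_scale g(1) h(1))
    then have "x = f + \<delta> n ?h"
      by (simp add: g h fun_eq_iff)
    ultimately show "x \<in> f +o \<delta> n ` cochain n" by (auto simp: elt_set_plus_def)
  qed
qed

text \<open>A quotient is zero when it has a single coset: exactness collapses all cocycles into the
  coset of 0, and the zero cocycle shows that this coset occurs.\<close>

lemma cohomology_galois_object:
  assumes "B = range (\<lambda>r. sA r 1)" "n > 0"
  shows "carr (cohomology sA sC \<psi> sM lact ract n) = {0 +o coboundaries sA sC \<psi> sM lact ract n}"
proof -
  obtain m where n: "n = Suc m" using assms(2) by (cases n) auto
  have im: "coboundaries sA sC \<psi> sM lact ract n = \<delta> m ` cochain m"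
    by (simp add: coboundaries_def n cochains_def)
  have "0 \<in> cocycles sA sC \<psi> sM lact ract n"
    by (simp add: cocycles_eq cochain_zero coboundary_zero)
  moreover have "f +o \<delta> m ` cochain m = 0 +o \<delta> m ` cochain m" if "f \<in> cocycles sA sC \<psi> sM lact ract n" for f
    using coset_coboundary galois_object_exact[OF assms(1)] that by (simp add: cocycles_eq n)
  ultimately show ?thesis
    by (auto simp: cohomology_def quotient_space_def im)
qed

end

theorem proposition2p6:
  fixes sA :: "'k::field \<Rightarrow> 'a::{ring,monoid_mult} \<Rightarrow> 'a"
    and sC :: "'k \<Rightarrow> 'c::ab_group_add \<Rightarrow> 'c"
    and sM :: "'k \<Rightarrow> 'm::ab_group_add \<Rightarrow> 'm"
    and \<Delta> :: "'c \<Rightarrow> ('c \<times> 'c \<Rightarrow>\<^sub>0 'k) set"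
    and \<epsilon> :: "'c \<Rightarrow> 'k"
    and \<rho> :: "'a \<Rightarrow> ('a \<times> 'c \<Rightarrow>\<^sub>0 'k) set"
    and lact :: "'a \<Rightarrow> 'm \<Rightarrow> 'm"
    and ract :: "'m \<Rightarrow> 'a \<Rightarrow> 'm"
  assumes "galois_extension sA sC \<Delta> \<epsilon> \<rho>"
    and "bimodule sA sM lact ract"
  shows "let B = coinvariants sA sC \<rho>; \<psi> = canonical_entwining sA sC \<rho> in
    kspace_iso (cohomology sA sC \<psi> sM lact ract 0)
      \<lparr>carr = {m. \<forall>b\<in>B. lact b m = ract m b}, scal = sM\<rparr> \<and>
    (B = range (\<lambda>r. sA r 1) \<longrightarrow>
      (\<forall>n>0. carr (cohomology sA sC \<psi> sM lact ract n) =
         {0 +o coboundaries sA sC \<psi> sM lact ract n}))"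
proof -
  interpret galois_bimodule sA sC \<Delta> \<epsilon> \<rho> sM lact ract
    using assms by (rule galois_bimodule.intro)
  show ?thesis
    unfolding Let_def using cohomology_0 cohomology_galois_object by blast
qed

end
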